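(* Let $n\ge1$ and let $\xi,\eta,\zeta$ be real constants. Let $$\Phi_1=\tfrac12(x^{-2}+y^2)\sum_{i=1}^n\Sigma_i^{-2}-x^{-1}\sum_{i=1}^n(\cos p_i)\sqrt{1+\Sigma_i^{-2}}\sqrt{x^2+y^2\Sigma_i^{-2}}\prod_{k\ne i}\frac{\sqrt{\alpha^{-1}\Sigma_k^2-\alpha\Sigma_i^2}\,\sqrt{\alpha\Sigma_k^2-\alpha^{-1}\Sigma_i^2}}{\Sigma_k^2-\Sigma_i^2},$$ with symplectic form proportional to $\sum_{i=1}^n dp_i\wedge\Sigma_i^{-1}d\Sigma_i$, where $\Sigma_i=\sinh\Delta_i$, $\Gamma_i=\cosh\Delta_i$, $\Delta_1>\dots>\Delta_n$. Substitute $$x=e^{t\xi},\quad y=e^{t\eta},\quad \alpha=e^{t\zeta},\quad p_i=t\pi_i,$$ and put $\hat p_i=\Sigma_i^{-1}\Gamma_i\pi_i$, $\hat q_i=\Delta_i$. Then, as $t\to0$, $$\Phi_1=H_0+tH_1+t^2H_2+\cdots,\qquad H_0=-n,\quad H_1=0,$$ and, after a rescaling of the symplectic structure by a constant factor (depending on $t$ only), the symplectic structure takes the form $\sum_{i=1}^n d\hat p_i\wedge d\hat q_i$ and the limit of the system as $t\to0$ is the Hamiltonian system with Hamiltonian $H_2$ and canonical coordinates $(\hat q_i,\hat p_i)$. Here $H_2$ is the general (three-parameter) hyperbolic $BC_n$ Sutherland Hamiltonian: $$H_2=\tfrac12\sum_{i=1}^n\hat p_i^2+c_1\sum_{i=1}^n\frac1{\sinh^2\hat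 q_i}+c_2\sum_{i=1}^n\frac1{\sinh^2(2\hat q_i)}+c_3\sum_{i,j,\ i\ne j}\Bigl[\frac1{\sinh^2(\hat q_i+\hat q_j)}+\frac1{\sinh^2(\hat q_i-\hat q_j)}\Bigr],$$ with constants $c_1,c_2,c_3$ determined by $\xi,\eta,\zeta$.
   Context: $\Phi_1$ and the symplectic form are those of the reduced system obtained by Poisson Lie group reduction of the Heisenberg double of $SU(n,n)$, depending on the parameters $x,y>0$ and $\alpha$. The limit $t\to0$ ("linearisation") is the passage from the Heisenberg double to the cotangent bundle. The formulas are considered where they are defined (the $\Sigma_i$ nonzero with distinct squares). The product of square roots divided by $\Sigma_k^2-\Sigma_i^2$ is understood as the branch that tends to $1$ as $\alpha\to1$, i.e. as $\Bigl[1-\frac{(\alpha-\alpha^{-1})^2\Sigma_i^2\Sigma_k^2}{(\Sigma_i^2-\Sigma_k^2)^2}\Bigr]^{1/2}$. The last sum runs over pairs $(i,j)$ with $i\neq j$. *)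

theory Defs
  imports "HOL-Analysis.Analysis"
begin

text \<open>Phase space points are pairs (positions, momenta). The index type carries a linear
  order so that the ordering of the positions can be expressed.\<close>

type_synonym 'n phase = "(real ^ 'n) \<times> (real ^ 'n)"

definition phase_space :: "'n::{finite,linorder} phase set" where
  "phase_space = {(\<Delta>, p).
     (\<forall>i j. i < j \<longrightarrow> \<Delta> $ i > \<Delta> $ j) \<and>
     (\<forall>i. sinh (\<Delta> $ i) \<noteq> 0) \<and>
     (\<forall>i j. i \<noteq> j \<longrightarrow> (sinh (\<Delta> $ i))\<^sup>2 \<noteq> (sinh (\<Delta> $ j))\<^sup>2)}"

text \<open>The product of the two square roots, with radicands \<open>b / \<alpha> - \<alpha> * a\<close> and \<open>\<alpha> * b - a / \<alpha>\<close>, divided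
  by \<open>b - a\<close>, where \<open>a\<close> and \<open>b\<close> are the squares of \<open>S\<^sub>i\<close> and \<open>S\<^sub>k\<close>; the branch is the one
  tending to 1 as \<open>\<alpha>\<close> tends to 1.\<close>

definition pair_factor :: "real \<Rightarrow> real \<Rightarrow> real \<Rightarrow> real" where
  "pair_factor \<alpha> Si Sk =
     sqrt (1 - (\<alpha> - inverse \<alpha>)\<^sup>2 * Si\<^sup>2 * Sk\<^sup>2 / (Si\<^sup>2 - Sk\<^sup>2)\<^sup>2)"

definition Phi1 :: "real \<Rightarrow> real \<Rightarrow> real \<Rightarrow> real ^ 'n::finite \<Rightarrow> real ^ 'n \<Rightarrow> real" where
  "Phi1 x y \<alpha> S p =
     1/2 * (1 / x\<^sup>2 + y\<^sup>2) * (\<Sum>i\<in>UNIV. 1 / (S $ i)\<^sup>2)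
     - 1 / x * (\<Sum>i\<in>UNIV. cos (p $ i) * sqrt (1 + 1 / (S $ i)\<^sup>2) * sqrt (x\<^sup>2 + y\<^sup>2 / (S $ i)\<^sup>2)
         * (\<Prod>k\<in>UNIV - {i}. pair_factor \<alpha> (S $ i) (S $ k)))"

text \<open>\<open>Phi1\<close> as a function of the coordinates \<open>(\<Delta>, p)\<close>.\<close>

definition Phi1_coord :: "real \<Rightarrow> real \<Rightarrow> real \<Rightarrow> 'n::finite phase \<Rightarrow> real" where
  "Phi1_coord x y \<alpha> z = Phi1 x y \<alpha> (\<chi> i. sinh (fst z $ i)) (snd z)"

definition sutherland_BC :: "real \<Rightarrow> real \<Rightarrow> real \<Rightarrow> 'n::finite phase \<Rightarrow> real" where
  "sutherland_BC c1 c2 c3 = (\<lambda>(q, p).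
     1/2 * (\<Sum>i\<in>UNIV. (p $ i)\<^sup>2)
     + c1 * (\<Sum>i\<in>UNIV. 1 / (sinh (q $ i))\<^sup>2)
     + c2 * (\<Sum>i\<in>UNIV. 1 / (sinh (2 * q $ i))\<^sup>2)
     + c3 * (\<Sum>(i, j)\<in>{(i, j). i \<noteq> j}.
         1 / (sinh (q $ i + q $ j))\<^sup>2 + 1 / (sinh (q $ i - q $ j))\<^sup>2))"

text \<open>A one-form at a point is a function of a tangent vector; a two-form is a function of a point
  and two tangent vectors.\<close>

abbreviation differential ::
    "('a::real_normed_vector \<Rightarrow> 'b::real_normed_vector) \<Rightarrow> 'a \<Rightarrow> 'a \<Rightarrow> 'b" where
  "differential f z \<equiv> frechet_derivative f (at z)"

definition wedge :: "('a \<Rightarrow> real) \<Rightarrow> ('a \<Rightarrow> real) \<Rightarrow> 'a \<Rightarrow> 'a \<Rightarrow> real" where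
  "wedge a b u v = a u * b v - a v * b u"

definition pullback ::
    "('a::real_normed_vector \<Rightarrow> 'b::real_normed_vector) \<Rightarrow> ('b \<Rightarrow> 'b \<Rightarrow> 'b \<Rightarrow> real)
      \<Rightarrow> 'a \<Rightarrow> 'a \<Rightarrow> 'a \<Rightarrow> real" where
  "pullback \<phi> \<omega> z u v = \<omega> (\<phi> z) (differential \<phi> z u) (differential \<phi> z v)"

definition canonical_form :: "'n::finite phase \<Rightarrow> 'n phase \<Rightarrow> 'n phase \<Rightarrow> real" where
  "canonical_form z u v =
     (\<Sum>i\<in>UNIV. wedge (differential (\<lambda>w. snd w $ i) z) (differential (\<lambda>w. fst w $ i) z) u v)"

text \<open>\<open>\<kappa>\<close> is the constant of proportionality.\<close>

definition reduced_form :: "real \<Rightarrow> 'n::finite phase \<Rightarrow> 'n phase \<Rightarrow> 'n phase \<Rightarrow> real" where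
  "reduced_form \<kappa> z u v =
     \<kappa> * (\<Sum>i\<in>UNIV. wedge (differential (\<lambda>w. snd w $ i) z)
       (\<lambda>w'. inverse (sinh (fst z $ i)) * differential (\<lambda>w. sinh (fst w $ i)) z w') u v)"

text \<open>The substitution \<open>(\<Delta>, \<pi>) \<mapsto> (\<Delta>, p) = (\<Delta>, t \<pi>)\<close>.\<close>

definition scale_momenta :: "real \<Rightarrow> 'n::finite phase \<Rightarrow> 'n phase" where
  "scale_momenta t = (\<lambda>(\<Delta>, \<pi>). (\<Delta>, t *\<^sub>R \<pi>))"

text \<open>The functions \<open>(\<Delta>, \<pi>) \<mapsto> (q, p)\<close> that become the canonical coordinates.\<close>

definition hat_coords :: "'n::finite phase \<Rightarrow> 'n phase" where
  "hat_coords = (\<lambda>(\<Delta>, \<pi>). (\<Delta>, \<chi> i. inverse (sinh (\<Delta> $ i)) * cosh (\<Delta> $ i) * \<pi> $ i))"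

text \<open>\<open>Phi1\<close> after the substitution, as a function of \<open>(\<Delta>, \<pi>)\<close>.\<close>

definition Phi1_subst :: "real \<Rightarrow> real \<Rightarrow> real \<Rightarrow> real \<Rightarrow> 'n::finite phase \<Rightarrow> real" where
  "Phi1_subst \<xi> \<eta> \<zeta> t z =
     Phi1_coord (exp (t * \<xi>)) (exp (t * \<eta>)) (exp (t * \<zeta>)) (scale_momenta t z)"

text \<open>The sign is such that the form \<open>dp \<and> dq\<close> gives \<open>q' = \<partial>H/\<partial>p\<close> and \<open>p' = - \<partial>H/\<partial>q\<close>.\<close>

definition hamiltonian_vector ::
    "('a::real_normed_vector \<Rightarrow> 'a \<Rightarrow> 'a \<Rightarrow> real) \<Rightarrow> ('a \<Rightarrow> real) \<Rightarrow> 'a \<Rightarrow> 'a \<Rightarrow> bool" where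
  "hamiltonian_vector \<omega> H z X \<longleftrightarrow>
     H differentiable (at z) \<and> (\<forall>v. \<omega> z X v = - differential H z v)"

end

theory Submission
  imports Defs "HOL-Complex_Analysis.Cauchy_Integral_Formula"
begin

text \<open>For \<open>t \<noteq> 0\<close> write \<open>\<Phi>\<^sub>1 = - n + t\<^sup>2 G\<^sub>t\<close>. With \<open>s\<^sub>i = 1 / sinh\<^sup>2 \<Delta>\<^sub>i\<close>, \<open>A = (x\<^sup>-\<^sup>2 + y\<^sup>2) / 2\<close> and
  \<open>R\<^sub>i\<close> the product of the two square roots in \<open>s\<^sub>i\<close> divided by \<open>x\<close>, one has
  \<open>t\<^sup>2 G\<^sub>t = \<Sum>\<^sub>i (A s\<^sub>i + 1 - R\<^sub>i) + R\<^sub>i (1 - cos p\<^sub>i \<Prod>\<^sub>k P\<^sub>i\<^sub>k)\<close>. After rationalising the square roots each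
  bracket divided by \<open>t\<^sup>2\<close> is an algebraic expression in functions that converge, together with
  their derivatives in \<open>(\<Delta>, \<pi>)\<close>, jointly as \<open>t\<close> tends to 0 and the point tends to a given point.
  The limit is the Sutherland Hamiltonian in the hat coordinates. Both symplectic forms are
  multiples of \<open>\<Sum> coth \<Delta>\<^sub>i d\<pi>\<^sub>i \<and> d\<Delta>\<^sub>i\<close>, so convergence of the derivatives is convergence of the
  Hamiltonian vector fields, and joint convergence makes it uniform on compact sets. The power
  series in \<open>t\<close> exists by holomorphic extension, and its first three coefficients are read off from
  \<open>- n + t\<^sup>2 G\<^sub>t\<close>.\<close>

section \<open>Convergence of functions together with their derivatives\<close>

text \<open>A tube-lemma argument: around every point of \<open>K\<close> the property holds on a
  box \<open>T\<close> times \<open>U\<close>. Finitely many \<open>U\<close> cover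
  \<open>K\<close>, and the finitely many conditions \<open>T\<close> hold eventually at the same
  time.\<close>

lemma eventually_all_compact:
  fixes A :: "'p filter" and K :: "'a::topological_space set"
  assumes "compact K" and "\<And>z. z \<in> K \<Longrightarrow> \<forall>\<^sub>F (t, w) in A \<times>\<^sub>F nhds z. P t w"
  shows "\<forall>\<^sub>F t in A. \<forall>z\<in>K. P t z"
proof -
  have "\<forall>z\<in>K. \<exists>p. eventually (fst p) A \<and> open (snd p) \<and> z \<in> snd p \<and>
      (\<forall>t w. fst p t \<longrightarrow> w \<in> snd p \<longrightarrow> P t w)"
  proof
    fix z assume z: "z \<in> K"
    obtain T Q where T: "eventually T A" and Q: "eventually Q (nhds z)"
      and TQ: "\<And>t w. T t \<Longrightarrow> Q w \<Longrightarrow> P t w"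
      using assms(2)[OF z] unfolding eventually_prod_filter by auto
    from Q obtain U where "open U" "z \<in> U" "\<forall>w\<in>U. Q w"
      by (auto simp: eventually_nhds)
    with T TQ show "\<exists>p. eventually (fst p) A \<and> open (snd p) \<and> z \<in> snd p \<and>
      (\<forall>t w. fst p t \<longrightarrow> w \<in> snd p \<longrightarrow> P t w)"
      by (intro exI[of _ "(T, U)"]) auto
  qed
  from bchoice[OF this] obtain p where p: "\<forall>z\<in>K. eventually (fst (p z)) A \<and> open (snd (p z)) \<and>
      z \<in> snd (p z) \<and> (\<forall>t w. fst (p z) t \<longrightarrow> w \<in> snd (p z) \<longrightarrow> P t w)" by (elim exE)
  define T U where "T z = fst (p z)" and "U z = snd (p z)" for z
  have TU: "\<And>z. z \<in> K \<Longrightarrow> eventually (T z) A" "\<And>z. z \<in> K \<Longrightarrow> open (U z)"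
      "\<And>z. z \<in> K \<Longrightarrow> z \<in> U z" "\<And>z t w. z \<in> K \<Longrightarrow> T z t \<Longrightarrow> w \<in> U z \<Longrightarrow> P t w"
    using p by (auto simp: T_def U_def)
  obtain D where D: "D \<subseteq> K" "finite D" "K \<subseteq> (\<Union>z\<in>D. U z)"
    using compactE_image[OF assms(1), of K U] TU(2,3) by blast
  have "\<forall>\<^sub>F t in A. \<forall>z\<in>D. T z t"
    using D TU(1) by (intro eventually_ball_finite) auto
  then show ?thesis
    by eventually_elim (use D TU(4) in blast)
qed

text \<open>Near \<open>z\<close>, joint convergence puts \<open>f t w\<close> within
  \<open>e / 3\<close> of \<open>g z\<close>; passing to the limit in \<open>t\<close> puts
  \<open>g w\<close> there as well. So the continuity of \<open>g\<close> along \<open>K\<close>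
  that uniformity requires comes out of joint convergence itself.\<close>

lemma uniform_limit_compact:
  fixes A :: "'p filter" and f :: "'p \<Rightarrow> 'a::topological_space \<Rightarrow> 'b::metric_space"
  assumes "compact K" and "A \<noteq> bot"
    and lim: "\<And>z. z \<in> K \<Longrightarrow> ((\<lambda>(t, w). f t w) \<longlongrightarrow> g z) (A \<times>\<^sub>F nhds z)"
  shows "uniform_limit K f g A"
proof (rule uniform_limitI)
  fix e :: real assume "0 < e"
  have pt: "((\<lambda>t. f t z) \<longlongrightarrow> g z) A" if "z \<in> K" for z
  proof -
    have "filterlim (\<lambda>t. (t, z)) (A \<times>\<^sub>F nhds z) A"
      by (intro filterlim_Pair filterlim_ident tendsto_const)
    from filterlim_compose[OF lim[OF that] this] show ?thesis by simp
  qed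
  \<comment> \<open>The guard \<open>z \<in> K\<close> sits inside the predicate because the boxes
    of \<open>eventually_all_compact\<close> also contain points outside \<open>K\<close>, where
    \<open>lim\<close> says nothing about \<open>g\<close>.\<close>
  have "\<forall>\<^sub>F t in A. \<forall>z\<in>K. z \<in> K \<longrightarrow> dist (f t z) (g z) < e"
  proof (rule eventually_all_compact[OF assms(1)])
    fix z assume z: "z \<in> K"
    have "\<forall>\<^sub>F (t, w) in A \<times>\<^sub>F nhds z. dist (f t w) (g z) < e / 3"
      using tendstoD[OF lim[OF z], of "e / 3"] \<open>0 < e\<close> by (simp add: case_prod_unfold)
    then obtain T Q where TQ: "eventually T A" "eventually Q (nhds z)"
      and *: "\<And>t w. T t \<Longrightarrow> Q w \<Longrightarrow> dist (f t w) (g z) < e / 3"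
      unfolding eventually_prod_filter by auto
    have near: "dist (g w) (g z) \<le> e / 3" if "Q w" "w \<in> K" for w
    proof (rule tendsto_upperbound)
      show "((\<lambda>t. dist (f t w) (g z)) \<longlongrightarrow> dist (g w) (g z)) A"
        by (intro tendsto_dist pt[OF that(2)] tendsto_const)
      show "\<forall>\<^sub>F t in A. dist (f t w) (g z) \<le> e / 3"
        using TQ(1) by eventually_elim (use *[OF _ that(1)] in force)
    qed fact
    have "dist (f t w) (g w) < e" if "T t" "Q w" "w \<in> K" for t w
      using *[OF that(1,2)] near[OF that(2,3)] \<open>0 < e\<close> dist_triangle2[of "f t w" "g w" "g z"] by linarith
    then show "\<forall>\<^sub>F (t, w) in A \<times>\<^sub>F nhds z. w \<in> K \<longrightarrow> dist (f t w) (g w) < e"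
      unfolding eventually_prod_filter using TQ by blast
  qed
  then show "\<forall>\<^sub>F t in A. \<forall>z\<in>K. dist (f t z) (g z) < e" by simp
qed

text \<open>Joint convergence along \<open>A \<times>\<^sub>F nhds z\<close>, rather than pointwise convergence in the parameter,
  makes the notion stable under composition and gives uniformity on compact sets.\<close>

definition C1_tendsto ::
    "('p \<Rightarrow> 'a::real_normed_vector \<Rightarrow> real) \<Rightarrow> ('a \<Rightarrow> real) \<Rightarrow> 'p filter \<Rightarrow> 'a \<Rightarrow> bool" where
  "C1_tendsto f g A z \<longleftrightarrow> (\<exists>f' g'.
     (\<forall>\<^sub>F (t, w) in A \<times>\<^sub>F nhds z. (f t has_derivative f' t w) (at w)) \<and>
     (g has_derivative g') (at z) \<and>
     ((\<lambda>(t, w). f t w) \<longlongrightarrow> g z) (A \<times>\<^sub>F nhds z) \<and>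
     (\<forall>v. ((\<lambda>(t, w). f' t w v) \<longlongrightarrow> g' v) (A \<times>\<^sub>F nhds z)))"

text \<open>Uniqueness of derivatives replaces the existential witnesses by
  \<open>frechet_derivative\<close>, the form in which Hamiltonian vector fields are
  written.\<close>

lemma C1_tendsto_frechet_derivative:
  assumes "C1_tendsto f g A z"
  shows "\<forall>\<^sub>F (t, w) in A \<times>\<^sub>F nhds z. f t differentiable at w"
    and "g differentiable at z"
    and "((\<lambda>(t, w). frechet_derivative (f t) (at w) v) \<longlongrightarrow> frechet_derivative g (at z) v)
           (A \<times>\<^sub>F nhds z)"
    and "((\<lambda>(t, w). f t w) \<longlongrightarrow> g z) (A \<times>\<^sub>F nhds z)"
proof -
  obtain f' g' where
    1: "\<forall>\<^sub>F (t, w) in A \<times>\<^sub>F nhds z. (f t has_derivative f' t w) (at w)" and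
    2: "(g has_derivative g') (at z)" and
    3: "((\<lambda>(t, w). f t w) \<longlongrightarrow> g z) (A \<times>\<^sub>F nhds z)" and
    4: "\<And>v. ((\<lambda>(t, w). f' t w v) \<longlongrightarrow> g' v) (A \<times>\<^sub>F nhds z)"
    using assms unfolding C1_tendsto_def by auto
  show "((\<lambda>(t, w). f t w) \<longlongrightarrow> g z) (A \<times>\<^sub>F nhds z)" by (fact 3)
  show "g differentiable at z" using 2 by (auto simp: differentiable_def)
  show "\<forall>\<^sub>F (t, w) in A \<times>\<^sub>F nhds z. f t differentiable at w"
    using 1 by eventually_elim (auto simp: differentiable_def)
  have "\<forall>\<^sub>F (t, w) in A \<times>\<^sub>F nhds z. f' t w v = frechet_derivative (f t) (at w) v"
    using 1 by eventually_elim (auto dest: frechet_derivative_at)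
  then show "((\<lambda>(t, w). frechet_derivative (f t) (at w) v) \<longlongrightarrow> frechet_derivative g (at z) v)
           (A \<times>\<^sub>F nhds z)"
    using 4[of v] frechet_derivative_at[OF 2]
    by (auto simp: case_prod_unfold elim!: Lim_transform_eventually)
qed

lemma C1_tendsto_cong:
  assumes "C1_tendsto f g A z"
    and "\<forall>\<^sub>F (t, w) in A \<times>\<^sub>F nhds z. f t w = f2 t w" and "\<forall>\<^sub>F w in nhds z. g w = g2 w"
  shows "C1_tendsto f2 g2 A z"
proof -
  obtain f' g' where
    1: "\<forall>\<^sub>F (t, w) in A \<times>\<^sub>F nhds z. (f t has_derivative f' t w) (at w)" and
    2: "(g has_derivative g') (at z)" and
    3: "((\<lambda>(t, w). f t w) \<longlongrightarrow> g z) (A \<times>\<^sub>F nhds z)" and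
    4: "\<And>v. ((\<lambda>(t, w). f' t w v) \<longlongrightarrow> g' v) (A \<times>\<^sub>F nhds z)"
    using assms(1) unfolding C1_tendsto_def by auto
  \<comment> \<open>Transferring a derivative at \<open>w\<close> takes equality on a whole
    neighbourhood of \<open>w\<close>. A property that holds near \<open>z\<close> also holds near
    every \<open>w\<close> close to \<open>z\<close>, which upgrades the pointwise equality.\<close>
  have "\<forall>\<^sub>F (t, w) in A \<times>\<^sub>F nhds z. \<forall>\<^sub>F w' in nhds w. f t w' = f2 t w'"
  proof -
    obtain T Q where "eventually T A" "eventually Q (nhds z)"
      and TQ: "\<And>t w. T t \<Longrightarrow> Q w \<Longrightarrow> f t w = f2 t w"
      using assms(2) unfolding eventually_prod_filter by auto
    moreover from this have "\<forall>\<^sub>F w in nhds z. eventually Q (nhds w)"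
      by (simp add: eventually_eventually)
    ultimately show ?thesis unfolding eventually_prod_filter
      by (auto intro!: exI[of _ T] exI[of _ "\<lambda>w. eventually Q (nhds w)"] elim: eventually_mono)
  qed
  with 1 have "\<forall>\<^sub>F (t, w) in A \<times>\<^sub>F nhds z. (f2 t has_derivative f' t w) (at w)"
  proof eventually_elim
    case (elim x)
    then show ?case
      by (auto simp: case_prod_unfold dest: eventually_nhds_x_imp_x
          intro: has_derivative_transform_eventually[OF _ eventually_nhds_conv_at[THEN iffD1, THEN conjunct1]])
  qed
  moreover have "(g2 has_derivative g') (at z)"
    using 2 assms(3)
    by (auto dest: eventually_nhds_x_imp_x
          intro: has_derivative_transform_eventually[OF _ eventually_nhds_conv_at[THEN iffD1, THEN conjunct1]])
  moreover have "((\<lambda>(t, w). f2 t w) \<longlongrightarrow> g2 z) (A \<times>\<^sub>F nhds z)"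
    using 3 assms(2) eventually_nhds_x_imp_x[OF assms(3)]
    by (auto simp: case_prod_unfold elim!: Lim_transform_eventually)
  ultimately show ?thesis using 4 unfolding C1_tendsto_def by blast
qed

section \<open>Calculus rules for joint convergence with derivatives\<close>

lemma C1_tendsto_param:
  assumes "(c \<longlongrightarrow> c0) A"
  shows "C1_tendsto (\<lambda>t _. c t) (\<lambda>_. c0) A z"
  unfolding C1_tendsto_def
  using filterlim_compose[OF assms filterlim_fst]
  by (intro exI[of _ "\<lambda>_ _ _. 0"] exI[of _ "\<lambda>_. 0"]) (auto simp: case_prod_unfold)

lemmas C1_tendsto_const = C1_tendsto_param[OF tendsto_const]

lemma C1_tendsto_linear:
  assumes "bounded_linear f"
  shows "C1_tendsto (\<lambda>_. f) f A z"
  unfolding C1_tendsto_def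
  using bounded_linear.tendsto[OF assms filterlim_snd]
  by (intro exI[of _ "\<lambda>_ _. f"] exI[of _ "f"])
     (auto simp: case_prod_unfold bounded_linear_imp_has_derivative[OF assms])

lemma C1_tendsto_add:
  assumes "C1_tendsto f f0 A z" "C1_tendsto g g0 A z"
  shows "C1_tendsto (\<lambda>t w. f t w + g t w) (\<lambda>w. f0 w + g0 w) A z"
proof -
  obtain f' f0' where
    f: "\<forall>\<^sub>F (t, w) in A \<times>\<^sub>F nhds z. (f t has_derivative f' t w) (at w)"
       "(f0 has_derivative f0') (at z)" "((\<lambda>(t, w). f t w) \<longlongrightarrow> f0 z) (A \<times>\<^sub>F nhds z)"
       "\<And>v. ((\<lambda>(t, w). f' t w v) \<longlongrightarrow> f0' v) (A \<times>\<^sub>F nhds z)"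
    using assms(1) unfolding C1_tendsto_def by auto
  obtain g' g0' where
    g: "\<forall>\<^sub>F (t, w) in A \<times>\<^sub>F nhds z. (g t has_derivative g' t w) (at w)"
       "(g0 has_derivative g0') (at z)" "((\<lambda>(t, w). g t w) \<longlongrightarrow> g0 z) (A \<times>\<^sub>F nhds z)"
       "\<And>v. ((\<lambda>(t, w). g' t w v) \<longlongrightarrow> g0' v) (A \<times>\<^sub>F nhds z)"
    using assms(2) unfolding C1_tendsto_def by auto
  show ?thesis unfolding C1_tendsto_def
  proof (intro exI conjI allI)
    show "\<forall>\<^sub>F (t, w) in A \<times>\<^sub>F nhds z.
        ((\<lambda>w. f t w + g t w) has_derivative (\<lambda>v. f' t w v + g' t w v)) (at w)"
      using f(1) g(1) by eventually_elim (auto intro: has_derivative_add)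
    show "((\<lambda>w. f0 w + g0 w) has_derivative (\<lambda>v. f0' v + g0' v)) (at z)"
      by (intro has_derivative_add f g)
  qed (use f(3,4) g(3,4) in \<open>auto simp: case_prod_unfold intro!: tendsto_add\<close>)
qed

lemma C1_tendsto_mult:
  assumes "C1_tendsto f f0 A z" "C1_tendsto g g0 A z"
  shows "C1_tendsto (\<lambda>t w. f t w * g t w) (\<lambda>w. f0 w * g0 w) A z"
proof -
  obtain f' f0' where
    f: "\<forall>\<^sub>F (t, w) in A \<times>\<^sub>F nhds z. (f t has_derivative f' t w) (at w)"
       "(f0 has_derivative f0') (at z)" "((\<lambda>(t, w). f t w) \<longlongrightarrow> f0 z) (A \<times>\<^sub>F nhds z)"
       "\<And>v. ((\<lambda>(t, w). f' t w v) \<longlongrightarrow> f0' v) (A \<times>\<^sub>F nhds z)"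
    using assms(1) unfolding C1_tendsto_def by auto
  obtain g' g0' where
    g: "\<forall>\<^sub>F (t, w) in A \<times>\<^sub>F nhds z. (g t has_derivative g' t w) (at w)"
       "(g0 has_derivative g0') (at z)" "((\<lambda>(t, w). g t w) \<longlongrightarrow> g0 z) (A \<times>\<^sub>F nhds z)"
       "\<And>v. ((\<lambda>(t, w). g' t w v) \<longlongrightarrow> g0' v) (A \<times>\<^sub>F nhds z)"
    using assms(2) unfolding C1_tendsto_def by auto
  show ?thesis unfolding C1_tendsto_def
  proof (intro exI conjI allI)
    show "\<forall>\<^sub>F (t, w) in A \<times>\<^sub>F nhds z.
        ((\<lambda>w. f t w * g t w) has_derivative (\<lambda>v. f t w * g' t w v + f' t w v * g t w)) (at w)"
      using f(1) g(1) by eventually_elim (auto intro: has_derivative_mult)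
    show "((\<lambda>w. f0 w * g0 w) has_derivative (\<lambda>v. f0 z * g0' v + f0' v * g0 z)) (at z)"
      by (intro has_derivative_mult f g)
  qed (use f(3,4) g(3,4) in \<open>auto simp: case_prod_unfold intro!: tendsto_add tendsto_mult\<close>)
qed

text \<open>The chain rule gives \<open>g' t (f t w) (f' t w v)\<close>, where the direction itself
  moves with \<open>t\<close> and \<open>w\<close>, while convergence of \<open>g'\<close> is known
  only for fixed directions. On the real line linearity turns this into
  \<open>f' t w v * g' t (f t w) 1\<close>, a product of two convergent terms.\<close>

lemma C1_tendsto_compose:
  fixes g :: "'p \<Rightarrow> real \<Rightarrow> real"
  assumes "C1_tendsto g g0 A (f0 z)" "C1_tendsto f f0 A z"
  shows "C1_tendsto (\<lambda>t w. g t (f t w)) (\<lambda>w. g0 (f0 w)) A z"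
proof -
  obtain f' f0' where
    f: "\<forall>\<^sub>F (t, w) in A \<times>\<^sub>F nhds z. (f t has_derivative f' t w) (at w)"
       "(f0 has_derivative f0') (at z)" "((\<lambda>(t, w). f t w) \<longlongrightarrow> f0 z) (A \<times>\<^sub>F nhds z)"
       "\<And>v. ((\<lambda>(t, w). f' t w v) \<longlongrightarrow> f0' v) (A \<times>\<^sub>F nhds z)"
    using assms(2) unfolding C1_tendsto_def by auto
  obtain g' g0' where
    g: "\<forall>\<^sub>F (t, w) in A \<times>\<^sub>F nhds (f0 z). (g t has_derivative g' t w) (at w)"
       "(g0 has_derivative g0') (at (f0 z))" "((\<lambda>(t, w). g t w) \<longlongrightarrow> g0 (f0 z)) (A \<times>\<^sub>F nhds (f0 z))"
       "\<And>v. ((\<lambda>(t, w). g' t w v) \<longlongrightarrow> g0' v) (A \<times>\<^sub>F nhds (f0 z))"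
    using assms(1) unfolding C1_tendsto_def by auto
  have lim: "filterlim (\<lambda>(t, w). (t, f t w)) (A \<times>\<^sub>F nhds (f0 z)) (A \<times>\<^sub>F nhds z)"
    using f(3) filterlim_fst by (auto simp: case_prod_unfold intro!: filterlim_Pair)
  have lin: "g0' v = v * g0' 1" for v
    using linear_cmul[OF has_derivative_linear[OF g(2)], of v 1] by simp
  have ev: "\<forall>\<^sub>F (t, w) in A \<times>\<^sub>F nhds z. (g t has_derivative g' t (f t w)) (at (f t w))"
    using eventually_compose_filterlim[OF g(1) lim] by (simp add: case_prod_unfold)
  show ?thesis unfolding C1_tendsto_def
  proof (intro exI conjI allI)
    show "\<forall>\<^sub>F (t, w) in A \<times>\<^sub>F nhds z.
        ((\<lambda>w. g t (f t w)) has_derivative (\<lambda>v. f' t w v * g' t (f t w) 1)) (at w)"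
      using ev f(1)
    proof eventually_elim
      case (elim x)
      obtain t w where x: "x = (t, w)" by (cases x)
      have g: "(g t has_derivative g' t (f t w)) (at (f t w))" and f: "(f t has_derivative f' t w) (at w)"
        using elim x by auto
      have "g' t (f t w) v = v * g' t (f t w) 1" for v
        using linear_cmul[OF has_derivative_linear[OF g], of v 1] by simp
      then have "(\<lambda>v. g' t (f t w) (f' t w v)) = (\<lambda>v. f' t w v * g' t (f t w) 1)" by blast
      with has_derivative_compose[OF f g] x show ?case by simp
    qed
    show "((\<lambda>w. g0 (f0 w)) has_derivative (\<lambda>v. f0' v * g0' 1)) (at z)"
      using has_derivative_compose[OF f(2) g(2)] by (subst (asm) lin)
    show "((\<lambda>(t, w). g t (f t w)) \<longlongrightarrow> g0 (f0 z)) (A \<times>\<^sub>F nhds z)"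
      using filterlim_compose[OF g(3) lim] by (simp add: case_prod_unfold)
    show "((\<lambda>(t, w). f' t w v * g' t (f t w) 1) \<longlongrightarrow> f0' v * g0' 1) (A \<times>\<^sub>F nhds z)" for v
      using tendsto_mult[OF f(4)[of v] filterlim_compose[OF g(4)[of 1] lim]]
      by (simp add: case_prod_unfold)
  qed
qed

lemma C1_tendsto_real:
  fixes g :: "real \<Rightarrow> real"
  assumes "\<forall>\<^sub>F (t, w) in A \<times>\<^sub>F nhds u. (f t has_real_derivative f' t w) (at w)"
    and "(g has_real_derivative g') (at u)"
    and "((\<lambda>(t, w). f t w) \<longlongrightarrow> g u) (A \<times>\<^sub>F nhds u)" "((\<lambda>(t, w). f' t w) \<longlongrightarrow> g') (A \<times>\<^sub>F nhds u)"
  shows "C1_tendsto f g A u"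
  unfolding C1_tendsto_def
  using assms
  by (intro exI[of _ "\<lambda>t w v. f' t w * v"] exI[of _ "\<lambda>v. g' * v"])
     (auto simp: has_field_derivative_def case_prod_unfold intro!: tendsto_mult)

lemma C1_tendsto_fun:
  fixes g :: "real \<Rightarrow> real"
  assumes "\<forall>\<^sub>F w in nhds u. (g has_real_derivative g' w) (at w)" and "isCont g' u"
  shows "C1_tendsto (\<lambda>_. g) g A u"
proof (rule C1_tendsto_real)
  have s: "filterlim snd (nhds u) (A \<times>\<^sub>F nhds u)" by (rule filterlim_snd)
  show "\<forall>\<^sub>F (t, w) in A \<times>\<^sub>F nhds u. (g has_real_derivative g' w) (at w)"
    using eventually_compose_filterlim[OF assms(1) s] by (simp add: case_prod_unfold)
  show d: "(g has_real_derivative g' u) (at u)"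
    using eventually_nhds_x_imp_x[OF assms(1)] .
  show "((\<lambda>(t, w). g w) \<longlongrightarrow> g u) (A \<times>\<^sub>F nhds u)"
    using isCont_tendsto_compose[OF DERIV_isCont[OF d] s]
    by (simp add: case_prod_unfold)
  show "((\<lambda>(t, w). g' w) \<longlongrightarrow> g' u) (A \<times>\<^sub>F nhds u)"
    using isCont_tendsto_compose[OF assms(2) s] by (simp add: case_prod_unfold)
qed

lemma C1_tendsto_diff:
  assumes "C1_tendsto f f0 A z" "C1_tendsto g g0 A z"
  shows "C1_tendsto (\<lambda>t w. f t w - g t w) (\<lambda>w. f0 w - g0 w) A z"
  using C1_tendsto_add[OF assms(1) C1_tendsto_mult[OF C1_tendsto_const[of "-1"] assms(2)]] by simp

lemma C1_tendsto_sum: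
  assumes "\<And>i. i \<in> I \<Longrightarrow> C1_tendsto (f i) (f0 i) A z"
  shows "C1_tendsto (\<lambda>t w. \<Sum>i\<in>I. f i t w) (\<lambda>w. \<Sum>i\<in>I. f0 i w) A z"
  using assms by (induction I rule: infinite_finite_induct) (auto intro: C1_tendsto_const C1_tendsto_add)

lemma C1_tendsto_power:
  assumes "C1_tendsto f f0 A z"
  shows "C1_tendsto (\<lambda>t w. f t w ^ n) (\<lambda>w. f0 w ^ n) A z"
  by (induction n) (auto intro: C1_tendsto_const C1_tendsto_mult assms)

lemma C1_tendsto_compose_fun:
  fixes g :: "real \<Rightarrow> real"
  assumes "C1_tendsto f f0 A z"
    and "\<forall>\<^sub>F u in nhds (f0 z). (g has_real_derivative g' u) (at u)" "isCont g' (f0 z)"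
  shows "C1_tendsto (\<lambda>t w. g (f t w)) (\<lambda>w. g (f0 w)) A z"
  by (rule C1_tendsto_compose[OF C1_tendsto_fun[OF assms(2,3)] assms(1)])

lemma C1_tendsto_inverse:
  assumes "C1_tendsto f f0 A z" "f0 z \<noteq> 0"
  shows "C1_tendsto (\<lambda>t w. inverse (f t w)) (\<lambda>w. inverse (f0 w)) A z"
proof (rule C1_tendsto_compose_fun[OF assms(1), where g' = "\<lambda>u. - (inverse u ^ Suc (Suc 0))"])
  show "\<forall>\<^sub>F u in nhds (f0 z). (inverse has_real_derivative - (inverse u ^ Suc (Suc 0))) (at u)"
    using t1_space_nhds[OF assms(2)] by eventually_elim (rule DERIV_inverse)
  show "isCont (\<lambda>u. - (inverse u ^ Suc (Suc 0))) (f0 z)"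
    using assms(2) by (auto intro!: continuous_intros)
qed

lemma C1_tendsto_divide:
  assumes "C1_tendsto f f0 A z" "C1_tendsto g g0 A z" "g0 z \<noteq> 0"
  shows "C1_tendsto (\<lambda>t w. f t w / g t w) (\<lambda>w. f0 w / g0 w) A z"
  using C1_tendsto_mult[OF assms(1) C1_tendsto_inverse[OF assms(2,3)]] by (simp add: divide_inverse)

lemma C1_tendsto_sqrt:
  assumes "C1_tendsto f f0 A z" "f0 z > 0"
  shows "C1_tendsto (\<lambda>t w. sqrt (f t w)) (\<lambda>w. sqrt (f0 w)) A z"
proof (rule C1_tendsto_compose_fun[OF assms(1), where g' = "\<lambda>u. inverse (sqrt u) / 2"])
  have "\<forall>\<^sub>F u in nhds (f0 z). u \<in> {0<..}"
    using assms(2) by (intro eventually_nhds_in_open) auto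
  then show "\<forall>\<^sub>F u in nhds (f0 z). (sqrt has_real_derivative inverse (sqrt u) / 2) (at u)"
    by eventually_elim (auto intro: DERIV_real_sqrt)
  show "isCont (\<lambda>u. inverse (sqrt u) / 2) (f0 z)"
    using assms(2) by (auto intro!: continuous_intros)
qed

lemma C1_tendsto_sinh:
  assumes "C1_tendsto f f0 A z"
  shows "C1_tendsto (\<lambda>t w. sinh (f t w)) (\<lambda>w. sinh (f0 w)) A z"
  by (rule C1_tendsto_compose_fun[OF assms, where g' = cosh])
     (auto intro!: always_eventually derivative_eq_intros continuous_intros)

text \<open>If every factor is 1 minus a term of order \<open>d\<close>, the first-order terms of
  the product add up. The induction uses \<open>1 - f P = (1 - f) + f (1 - P)\<close>, with
  \<open>f\<close> rewritten as \<open>1 - d ((1 - f) / d)\<close> so that its convergence to 1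
  follows from the hypotheses on \<open>d\<close> and on the quotient.\<close>

lemma C1_tendsto_one_minus_prod:
  assumes "finite I" and d: "(d \<longlongrightarrow> 0) A" "\<forall>\<^sub>F t in A. d t \<noteq> 0"
    and f: "\<And>i. i \<in> I \<Longrightarrow> C1_tendsto (\<lambda>t w. (1 - f i t w) / d t) (l i) A z"
  shows "C1_tendsto (\<lambda>t w. (1 - (\<Prod>i\<in>I. f i t w)) / d t) (\<lambda>w. \<Sum>i\<in>I. l i w) A z"
  using assms(1) f
proof (induction I rule: finite_induct)
  case empty
  then show ?case by (simp add: C1_tendsto_const)
next
  case (insert j I)
  let ?P = "\<lambda>t w. (\<Prod>i\<in>I. f i t w)"
  have j: "C1_tendsto (\<lambda>t w. (1 - f j t w) / d t) (l j) A z" using insert by auto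
  have "C1_tendsto (\<lambda>t w. (1 - f j t w) / d t + (1 - d t * ((1 - f j t w) / d t)) * ((1 - ?P t w) / d t))
          (\<lambda>w. l j w + (1 - 0 * l j w) * (\<Sum>i\<in>I. l i w)) A z"
    by (intro C1_tendsto_add C1_tendsto_mult C1_tendsto_diff C1_tendsto_const C1_tendsto_param
        d j insert.IH insert.prems) auto
  moreover have "\<forall>\<^sub>F (t, w) in A \<times>\<^sub>F nhds z. d t \<noteq> 0"
    using eventually_compose_filterlim[OF d(2) filterlim_fst] by (simp add: case_prod_unfold)
  then have "\<forall>\<^sub>F (t, w) in A \<times>\<^sub>F nhds z.
      (1 - f j t w) / d t + (1 - d t * ((1 - f j t w) / d t)) * ((1 - ?P t w) / d t)
      = (1 - (\<Prod>i\<in>insert j I. f i t w)) / d t"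
    by eventually_elim (use insert.hyps in \<open>auto simp: field_simps\<close>)
  ultimately show ?case
    by (rule C1_tendsto_cong) (use insert.hyps in simp)
qed

section \<open>Second-order limit of the cosine\<close>

lemma tendsto_at_fst: "(fst \<longlongrightarrow> c) ((at c within S) \<times>\<^sub>F B)"
  by (rule filterlim_mono[OF filterlim_fst at_within_le_nhds order_refl])

lemma isCont_sinc: "isCont (\<lambda>x::real. if x = 0 then 1 else sin x / x) 0"
proof -
  have "((\<lambda>x::real. sin x / x) \<longlongrightarrow> 1) (at 0)"
    using DERIV_sin[of "0::real"] by (simp add: has_field_derivative_iff)
  then have "((\<lambda>x::real. if x = 0 then 1 else sin x / x) \<longlongrightarrow> 1) (at 0)"
    by (rule Lim_transform_eventually) (auto simp: eventually_at_filter)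
  then show ?thesis by (simp add: isCont_def)
qed

text \<open>The half-angle formula writes the quotient as \<open>u^2 / 2\<close> times the square of
  sinc at \<open>t u / 2\<close>, and its derivative \<open>sin (t u) / t\<close> is
  \<open>u\<close> times sinc at \<open>t u\<close>. Both limits then reduce to continuity of sinc
  at 0.\<close>

lemma C1_tendsto_cos:
  "C1_tendsto (\<lambda>t u. (1 - cos (t * u)) / t\<^sup>2) (\<lambda>u. u\<^sup>2 / 2) (at 0) (u0::real)"
proof -
  \<comment> \<open>The value 1 at 0 matters: along the product filter \<open>t\<close> is nonzero,
    but \<open>w\<close> and hence \<open>t * w\<close> may vanish.\<close>
  define S where "S = (\<lambda>x::real. if x = 0 then 1 else sin x / x)"
  let ?F = "at (0::real) \<times>\<^sub>F nhds u0"
  have S: "x * S x = sin x" for x by (simp add: S_def)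
  have lim: "((\<lambda>(t, w). S (c * (t * w))) \<longlongrightarrow> 1) ?F" for c
  proof -
    have "((\<lambda>x. c * (fst x * snd x)) \<longlongrightarrow> c * (0 * u0)) ?F"
      by (intro tendsto_intros tendsto_at_fst filterlim_snd)
    then have "((\<lambda>x. c * (fst x * snd x)) \<longlongrightarrow> 0) ?F" by simp
    from isCont_tendsto_compose[OF isCont_sinc this] show ?thesis
      by (simp add: S_def case_prod_unfold)
  qed
  have snd: "(snd \<longlongrightarrow> u0) ?F" by (rule filterlim_snd)
  have ne: "\<forall>\<^sub>F (t, w) in ?F. t \<noteq> 0"
  proof -
    have "\<forall>\<^sub>F t in at (0::real). t \<noteq> 0" by (simp add: eventually_at_filter)
    from eventually_compose_filterlim[OF this filterlim_fst] show ?thesis by (simp add: case_prod_unfold)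
  qed
  show ?thesis
  proof (rule C1_tendsto_real)
    show "\<forall>\<^sub>F (t, w) in ?F. ((\<lambda>u. (1 - cos (t * u)) / t\<^sup>2) has_real_derivative sin (t * w) / t) (at w)"
      using ne by eventually_elim (auto intro!: derivative_eq_intros simp: power2_eq_square)
    show "((\<lambda>u. u\<^sup>2 / 2) has_real_derivative u0) (at u0)"
      by (auto intro!: derivative_eq_intros)
    have "((\<lambda>(t, w). w\<^sup>2 / 2 * (S (1/2 * (t * w)))\<^sup>2) \<longlongrightarrow> u0\<^sup>2 / 2 * 1\<^sup>2) ?F"
      using lim[of "1/2"] snd unfolding case_prod_unfold
      by (intro tendsto_intros) auto
    moreover have "\<forall>\<^sub>F x in ?F. (case x of (t, w) \<Rightarrow> w\<^sup>2 / 2 * (S (1/2 * (t * w)))\<^sup>2) = (case x of (t, w) \<Rightarrow> (1 - cos (t * w)) / t\<^sup>2)"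
      using ne
    proof eventually_elim
      case (elim x)
      obtain t w where x: "x = (t, w)" by (cases x)
      have "w\<^sup>2 / 2 * (S (1/2 * (t * w)))\<^sup>2 = 2 * ((1/2 * (t * w)) * S (1/2 * (t * w)))\<^sup>2 / t\<^sup>2"
        using elim x by (simp add: field_simps power2_eq_square)
      also have "\<dots> = (1 - cos (2 * (1/2 * (t * w)))) / t\<^sup>2"
        unfolding S cos_double_sin by simp
      finally show ?case by (simp only: x prod.case) simp
    qed
    ultimately show "((\<lambda>(t, u). (1 - cos (t * u)) / t\<^sup>2) \<longlongrightarrow> u0\<^sup>2 / 2) ?F"
      by (auto intro: Lim_transform_eventually)
    have "((\<lambda>(t, w). w * S (1 * (t * w))) \<longlongrightarrow> u0 * 1) ?F"
      using lim[of 1] snd unfolding case_prod_unfold by (intro tendsto_intros) auto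
    moreover have "\<forall>\<^sub>F x in ?F. (case x of (t, w) \<Rightarrow> w * S (1 * (t * w))) = (case x of (t, w) \<Rightarrow> sin (t * w) / t)"
      using ne by eventually_elim (auto simp: S_def)
    ultimately show "((\<lambda>(t, w). sin (t * w) / t) \<longlongrightarrow> u0) ?F"
      by (auto intro: Lim_transform_eventually)
  qed
qed

section \<open>Real analyticity at 0\<close>

text \<open>Analyticity is expressed through a holomorphic extension, so that the power series comes
  from the Cauchy integral formula.\<close>

definition real_analytic_at_0 :: "(real \<Rightarrow> real) \<Rightarrow> bool" where
  "real_analytic_at_0 f \<longleftrightarrow> (\<exists>g. g analytic_on {0} \<and> (\<forall>\<^sub>F t in nhds 0. g (complex_of_real t) = of_real (f t)))"

lemma real_analytic_at_0_const: "real_analytic_at_0 (\<lambda>_. c)"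
  unfolding real_analytic_at_0_def by (intro exI[of _ "\<lambda>_. of_real c"]) auto

lemma real_analytic_at_0_ident: "real_analytic_at_0 (\<lambda>t. t)"
  unfolding real_analytic_at_0_def by (intro exI[of _ "\<lambda>z. z"]) auto

lemma real_analytic_at_0_add:
  assumes "real_analytic_at_0 f" "real_analytic_at_0 g"
  shows "real_analytic_at_0 (\<lambda>t. f t + g t)"
proof -
  obtain F G where "F analytic_on {0}" "G analytic_on {0}"
    and *: "\<forall>\<^sub>F t in nhds 0. F (complex_of_real t) = of_real (f t)" "\<forall>\<^sub>F t in nhds 0. G (complex_of_real t) = of_real (g t)"
    using assms unfolding real_analytic_at_0_def by auto
  then have "(\<lambda>z. F z + G z) analytic_on {0}" by (intro analytic_intros)
  moreover have "\<forall>\<^sub>F t in nhds 0. F (complex_of_real t) + G (complex_of_real t) = of_real (f t + g t)"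
    using * by eventually_elim simp
  ultimately show ?thesis unfolding real_analytic_at_0_def by blast
qed

lemma real_analytic_at_0_mult:
  assumes "real_analytic_at_0 f" "real_analytic_at_0 g"
  shows "real_analytic_at_0 (\<lambda>t. f t * g t)"
proof -
  obtain F G where "F analytic_on {0}" "G analytic_on {0}"
    and *: "\<forall>\<^sub>F t in nhds 0. F (complex_of_real t) = of_real (f t)" "\<forall>\<^sub>F t in nhds 0. G (complex_of_real t) = of_real (g t)"
    using assms unfolding real_analytic_at_0_def by auto
  then have "(\<lambda>z. F z * G z) analytic_on {0}" by (intro analytic_intros)
  moreover have "\<forall>\<^sub>F t in nhds 0. F (complex_of_real t) * G (complex_of_real t) = of_real (f t * g t)"
    using * by eventually_elim simp
  ultimately show ?thesis unfolding real_analytic_at_0_def by blast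
qed

lemma real_analytic_at_0_diff:
  assumes "real_analytic_at_0 f" "real_analytic_at_0 g"
  shows "real_analytic_at_0 (\<lambda>t. f t - g t)"
  using real_analytic_at_0_add[OF assms(1) real_analytic_at_0_mult[OF real_analytic_at_0_const[of "-1"] assms(2)]]
  by simp

lemma real_analytic_at_0_power:
  assumes "real_analytic_at_0 f"
  shows "real_analytic_at_0 (\<lambda>t. f t ^ n)"
  by (induction n) (auto intro: real_analytic_at_0_const real_analytic_at_0_mult assms)

lemma real_analytic_at_0_sum:
  assumes "\<And>i. i \<in> I \<Longrightarrow> real_analytic_at_0 (f i)"
  shows "real_analytic_at_0 (\<lambda>t. \<Sum>i\<in>I. f i t)"
  using assms by (induction I rule: infinite_finite_induct)
    (auto intro: real_analytic_at_0_const real_analytic_at_0_add)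

lemma real_analytic_at_0_prod:
  assumes "\<And>i. i \<in> I \<Longrightarrow> real_analytic_at_0 (f i)"
  shows "real_analytic_at_0 (\<lambda>t. \<Prod>i\<in>I. f i t)"
  using assms by (induction I rule: infinite_finite_induct)
    (auto intro: real_analytic_at_0_const real_analytic_at_0_mult)

lemma real_analytic_at_0_compose:
  assumes "real_analytic_at_0 f" and "G analytic_on {of_real (f 0)}"
    and "\<forall>\<^sub>F x in nhds (f 0). G (complex_of_real x) = of_real (g x)"
  shows "real_analytic_at_0 (\<lambda>t. g (f t))"
proof -
  obtain F where F: "F analytic_on {0}"
    and *: "\<forall>\<^sub>F t in nhds 0. F (complex_of_real t) = of_real (f t)"
    using assms unfolding real_analytic_at_0_def by auto
  have F0: "F 0 = of_real (f 0)" using eventually_nhds_x_imp_x[OF *] by simp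
  have "(G \<circ> F) analytic_on {0}"
    by (rule analytic_on_compose[OF F]) (use assms(2) F0 in simp)
  moreover have "\<forall>\<^sub>F t in nhds 0. (G \<circ> F) (complex_of_real t) = of_real (g (f t))"
  proof -
    have "isCont F 0" using analytic_at_imp_isCont[OF F] .
    \<comment> \<open>Continuity of \<open>f\<close> at 0 is extracted from its holomorphic
      extension. The real part keeps the argument real, so that the agreement of \<open>G\<close>
      with \<open>g\<close> near \<open>f 0\<close> applies.\<close>
    then have "((\<lambda>t. Re (F (complex_of_real t))) \<longlongrightarrow> Re (F 0)) (nhds 0)"
      by (intro tendsto_Re isCont_tendsto_compose[of 0 F]) (auto intro!: tendsto_eq_intros filterlim_ident)
    then have "\<forall>\<^sub>F t in nhds 0. G (complex_of_real (Re (F (of_real t)))) = of_real (g (Re (F (of_real t))))"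
      using eventually_compose_filterlim[OF assms(3)] F0 by simp
    with * show ?thesis by eventually_elim simp
  qed
  ultimately show ?thesis unfolding real_analytic_at_0_def by blast
qed

lemma real_analytic_at_0_exp: "real_analytic_at_0 f \<Longrightarrow> real_analytic_at_0 (\<lambda>t. exp (f t))"
  by (rule real_analytic_at_0_compose[of f exp exp]) (auto intro: analytic_intros simp: exp_of_real)

lemma real_analytic_at_0_cos: "real_analytic_at_0 f \<Longrightarrow> real_analytic_at_0 (\<lambda>t. cos (f t))"
  by (rule real_analytic_at_0_compose[of f cos cos]) (auto intro: analytic_intros simp: cos_of_real)

lemma real_analytic_at_0_inverse:
  assumes "real_analytic_at_0 f" "f 0 \<noteq> 0"
  shows "real_analytic_at_0 (\<lambda>t. inverse (f t))"
  by (rule real_analytic_at_0_compose[of f inverse inverse, OF assms(1)]) (use assms(2) in \<open>auto intro!: analytic_intros\<close>)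

text \<open>A positive value at 0 keeps the argument away from the branch cut of
  \<open>csqrt\<close>.\<close>

lemma real_analytic_at_0_sqrt:
  assumes "real_analytic_at_0 f" "f 0 > 0"
  shows "real_analytic_at_0 (\<lambda>t. sqrt (f t))"
proof (rule real_analytic_at_0_compose[of f csqrt sqrt, OF assms(1)])
  show "csqrt analytic_on {complex_of_real (f 0)}"
    by (rule analytic_on_subset[OF analytic_on_csqrt]) (use assms(2) in auto)
  have "\<forall>\<^sub>F x in nhds (f 0). x \<in> {0<..}"
    using assms(2) by (intro eventually_nhds_in_open) auto
  then show "\<forall>\<^sub>F x in nhds (f 0). csqrt (complex_of_real x) = complex_of_real (sqrt x)"
    by eventually_elim (simp add: csqrt_of_real)
qed

lemma real_analytic_at_0_imp_sums:
  assumes "real_analytic_at_0 f"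
  obtains a where "\<forall>\<^sub>F t in nhds 0. (\<lambda>k. t ^ k * a k) sums f t"
proof -
  obtain F where F: "F analytic_on {0}"
    and *: "\<forall>\<^sub>F t in nhds 0. F (complex_of_real t) = of_real (f t)"
    using assms unfolding real_analytic_at_0_def by auto
  obtain r where r: "r > 0" "F holomorphic_on ball 0 r"
    using F analytic_at_ball by auto
  \<comment> \<open>The Taylor coefficients of the extension are complex numbers. At real
    \<open>t\<close> the powers are real and the sum is \<open>f t\<close>, so the series of real
    parts still sums to \<open>f t\<close>.\<close>
  define a where "a k = Re ((deriv ^^ k) F 0 / fact k)" for k
  have "\<forall>\<^sub>F t in nhds (0::real). t \<in> ball 0 r"
    using r by (intro eventually_nhds_in_open) auto
  with * have "\<forall>\<^sub>F t in nhds 0. (\<lambda>k. t ^ k * a k) sums f t"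
  proof eventually_elim
    case (elim t)
    have "(\<lambda>k. (deriv ^^ k) F 0 / fact k * (of_real t - 0) ^ k) sums F (of_real t)"
      by (rule holomorphic_power_series[OF r(2)]) (use elim in auto)
    from sums_Re[OF this] have "(\<lambda>k. Re (of_real (t ^ k) * ((deriv ^^ k) F 0 / fact k))) sums f t"
      using elim by (simp add: mult.commute)
    then show ?case unfolding a_def Re_complex_of_real times_complex.sel Im_complex_of_real by simp
  qed
  then show ?thesis by (rule that)
qed

section \<open>Reading off the first coefficients of a power series\<close>

lemma sums_shift_divide:
  fixes a :: "nat \<Rightarrow> real"
  assumes "(\<lambda>k. a k * t ^ k) sums s" "t \<noteq> 0"
  shows "(\<lambda>k. a (Suc k) * t ^ k) sums ((s - a 0) / t)"
proof -
  have "(\<lambda>k. a (Suc k) * t ^ Suc k) sums (s - a 0)"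
    using assms(1) by (subst sums_Suc_iff) simp
  from sums_divide[OF this, of t] show ?thesis using assms(2) by simp
qed

text \<open>A constant coefficient is the limit of its series at 0. Removing one coefficient at a
  time and dividing by \<open>t\<close>, the successive functions are \<open>f\<close>,
  \<open>t * g t\<close> and \<open>g\<close>, with limits \<open>b\<close>, 0 and
  \<open>c\<close>.\<close>

lemma power_series_second_order:
  fixes a :: "nat \<Rightarrow> real"
  assumes "\<forall>\<^sub>F t in nhds 0. (\<lambda>k. t ^ k * a k) sums f t"
    and f: "\<And>t. t \<noteq> 0 \<Longrightarrow> f t = b + t\<^sup>2 * g t" and g: "(g \<longlongrightarrow> c) (at 0)"
  shows "a 0 = b" "a 1 = 0" "a 2 = c"
proof -
  obtain r :: real where r: "r > 0" and s0: "\<And>t. norm t < r \<Longrightarrow> (\<lambda>k. a k * t ^ k) sums f t"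
    using assms(1) unfolding eventually_nhds_metric by (auto simp: dist_real_def mult.commute)
  have t: "((\<lambda>t::real. t) \<longlongrightarrow> 0) (at 0)" by (rule tendsto_ident_at)
  have "((\<lambda>t. b + t\<^sup>2 * g t) \<longlongrightarrow> b + 0\<^sup>2 * c) (at 0)" by (intro tendsto_intros t g)
  moreover have "\<forall>\<^sub>F t in at 0. b + t\<^sup>2 * g t = f t" using f by (simp add: eventually_at_filter)
  ultimately have "(f \<longlongrightarrow> b) (at 0)" by (auto intro: Lim_transform_eventually)
  then show a0: "a 0 = b"
    using powser_limit_0_strong[OF r, of a f] s0 LIM_unique by blast
  have s1: "(\<lambda>k. a (Suc k) * t ^ k) sums (t * g t)" if "t \<noteq> 0" "norm t < r" for t
    using sums_shift_divide[OF s0[OF that(2)] that(1)] f[OF that(1)] that(1) a0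
    by (simp add: power2_eq_square)
  have "((\<lambda>t. t * g t) \<longlongrightarrow> 0 * c) (at 0)" by (intro tendsto_intros t g)
  then show a1: "a 1 = 0"
    using powser_limit_0_strong[OF r, of "\<lambda>k. a (Suc k)" "\<lambda>t. t * g t"] s1 LIM_unique by fastforce
  have s2: "(\<lambda>k. a (Suc (Suc k)) * t ^ k) sums g t" if "t \<noteq> 0" "norm t < r" for t
    using sums_shift_divide[OF s1[OF that] that(1)] that(1) a1 by simp
  then show "a 2 = c"
    using powser_limit_0_strong[OF r, of "\<lambda>k. a (Suc (Suc k))" g] g LIM_unique
    by (fastforce simp: numeral_2_eq_2)
qed

section \<open>The reduced Hamiltonian\<close>

lemma open_phase_space: "open (phase_space :: 'n::{finite,linorder} phase set)"
proof -
  have "phase_space =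
      (\<Inter>i j. {z :: 'n phase. i < j \<longrightarrow> fst z $ j < fst z $ i}) \<inter> (\<Inter>i. {z. sinh (fst z $ i) \<noteq> 0}) \<inter>
      (\<Inter>i j. {z. i \<noteq> j \<longrightarrow> (sinh (fst z $ i))\<^sup>2 \<noteq> (sinh (fst z $ j))\<^sup>2})"
    by (auto simp: phase_space_def)
  also have "open \<dots>"
    by (intro open_Int open_INT ballI finite open_Collect_imp open_Collect_less open_Collect_neq
        closed_Collect_const continuous_intros)
  finally show ?thesis .
qed

lemma eventually_phase_space:
  "z \<in> phase_space \<Longrightarrow> \<forall>\<^sub>F w in nhds z. w \<in> phase_space"
  by (rule eventually_nhds_in_open[OF open_phase_space])

text \<open>This is the coefficient of \<open>(\<alpha> - inverse \<alpha>)\<^sup>2\<close> under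
  the root in \<open>pair_factor\<close>.\<close>

definition pair_potential :: "real \<Rightarrow> real \<Rightarrow> real" where
  "pair_potential a b = a\<^sup>2 * b\<^sup>2 / (a\<^sup>2 - b\<^sup>2)\<^sup>2"

section \<open>Second-order behaviour of the pair factors and the site terms\<close>

lemma tendsto_exp_quotient: "((\<lambda>t. (exp (t * c) - 1) / t) \<longlongrightarrow> c) (at (0::real))"
proof -
  have "((\<lambda>t. exp (t * c)) has_real_derivative c) (at 0)"
    by (auto intro!: derivative_eq_intros)
  then show ?thesis by (simp add: has_field_derivative_iff)
qed

text \<open>Rationalising, \<open>1 - sqrt (1 - d^2 Q) = d^2 Q / (1 + sqrt (1 - d^2 Q))\<close> with
  \<open>d = \<alpha> - 1 / \<alpha>\<close>. Since \<open>d / t\<close> tends to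
  \<open>2 \<zeta>\<close> and the denominator to 2, the limit is
  \<open>4 \<zeta>^2 Q / 2\<close>.\<close>

lemma C1_tendsto_pair_factor:
  assumes C1: "C1_tendsto (\<lambda>_. S) S (at (0::real)) z" "C1_tendsto (\<lambda>_. T) T (at (0::real)) z"
    and ne: "(S z)\<^sup>2 \<noteq> (T z)\<^sup>2"
  shows "C1_tendsto (\<lambda>t w. (1 - pair_factor (exp (t * \<zeta>)) (S w) (T w)) / t\<^sup>2)
           (\<lambda>w. 2 * \<zeta>\<^sup>2 * pair_potential (S w) (T w)) (at 0) z"
proof -
  define d where "d t = exp (t * \<zeta>) - inverse (exp (t * \<zeta>))" for t
  have d0: "((\<lambda>t. (d t)\<^sup>2) \<longlongrightarrow> 0) (at 0)"
    unfolding d_def by (auto intro!: tendsto_eq_intros)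
  have dt: "((\<lambda>t. (d t / t)\<^sup>2) \<longlongrightarrow> (\<zeta> - (- \<zeta>))\<^sup>2) (at 0)"
  proof (intro tendsto_power)
    have "d t / t = (exp (t * \<zeta>) - 1) / t - (exp (t * (- \<zeta>)) - 1) / t" for t
      by (simp add: d_def exp_minus diff_divide_distrib)
    then show "((\<lambda>t. d t / t) \<longlongrightarrow> (\<zeta> - (- \<zeta>))) (at 0)"
      by (simp only:) (intro tendsto_diff tendsto_exp_quotient)
  qed
  let ?Q = "\<lambda>w. pair_potential (S w) (T w)"
  have Q: "C1_tendsto (\<lambda>_. ?Q) ?Q (at (0::real)) z"
    unfolding pair_potential_def using ne
    by (intro C1_tendsto_divide C1_tendsto_mult C1_tendsto_power C1_tendsto_diff C1) (use C1 in auto)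
  have rad: "C1_tendsto (\<lambda>t w. 1 - (d t)\<^sup>2 * ?Q w) (\<lambda>w. 1 - 0 * ?Q w) (at 0) z"
    by (intro C1_tendsto_diff C1_tendsto_const C1_tendsto_mult C1_tendsto_param d0 Q)
  have "C1_tendsto (\<lambda>t w. (d t / t)\<^sup>2 * ?Q w / (1 + sqrt (1 - (d t)\<^sup>2 * ?Q w)))
      (\<lambda>w. (\<zeta> - (- \<zeta>))\<^sup>2 * ?Q w / (1 + sqrt (1 - 0 * ?Q w))) (at 0) z"
    by (intro C1_tendsto_divide C1_tendsto_add C1_tendsto_mult C1_tendsto_sqrt rad Q C1_tendsto_const
        C1_tendsto_param dt) auto
  \<comment> \<open>The radicand converges to 1, so it is eventually positive and squaring the root
    gives it back.\<close>
  moreover have "\<forall>\<^sub>F (t, w) in at 0 \<times>\<^sub>F nhds z. 1 - (d t)\<^sup>2 * ?Q w > 0"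
    using order_tendstoD(1)[OF C1_tendsto_frechet_derivative(4)[OF rad], of 0] by (simp add: case_prod_unfold)
  then have "\<forall>\<^sub>F (t, w) in at 0 \<times>\<^sub>F nhds z. (d t / t)\<^sup>2 * ?Q w / (1 + sqrt (1 - (d t)\<^sup>2 * ?Q w)) =
      (1 - pair_factor (exp (t * \<zeta>)) (S w) (T w)) / t\<^sup>2"
  proof eventually_elim
    case (elim x)
    obtain t w where x: "x = (t, w)" by (cases x)
    define P where "P = sqrt (1 - (d t)\<^sup>2 * ?Q w)"
    have P: "pair_factor (exp (t * \<zeta>)) (S w) (T w) = P"
      by (simp add: pair_factor_def P_def pair_potential_def d_def mult.assoc)
    have "P\<^sup>2 = 1 - (d t)\<^sup>2 * ?Q w" "P > 0" using elim x by (auto simp: P_def)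
    then have "(d t)\<^sup>2 * ?Q w = (1 - P) * (1 + P)" "1 + P \<noteq> 0" by (auto simp: algebra_simps power2_eq_square)
    then have "(d t)\<^sup>2 * ?Q w / (1 + P) = 1 - P" by simp
    then have "(d t / t)\<^sup>2 * ?Q w / (1 + P) = (1 - P) / t\<^sup>2"
      by (metis (no_types, opaque_lifting) divide_divide_eq_left mult.commute power_divide times_divide_eq_left)
    then show ?case by (simp add: x P P_def[symmetric])
  qed
  ultimately show ?thesis
    by (rule C1_tendsto_cong) (simp add: power2_eq_square)
qed

text \<open>\<open>s\<close> stands for \<open>1 / S\<^sub>i\<^sup>2\<close>.\<close>

definition site_weight :: "real \<Rightarrow> real \<Rightarrow> real \<Rightarrow> real" where
  "site_weight x y s = 1 / x * (sqrt (1 + s) * sqrt (x\<^sup>2 + y\<^sup>2 * s))"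

text \<open>At the limit both roots become \<open>sqrt (1 + s)\<close>, with product
  \<open>1 + s\<close>. Positivity is assumed near \<open>z\<close> because the limit functions have
  to agree on a neighbourhood.\<close>

lemma C1_tendsto_site_weight:
  assumes C1: "C1_tendsto (\<lambda>_. s) s (at (0::real)) z" and pos: "\<forall>\<^sub>F w in nhds z. s w > 0"
  shows "C1_tendsto (\<lambda>t w. site_weight (exp (t * \<xi>)) (exp (t * \<eta>)) (s w)) (\<lambda>w. 1 + s w) (at 0) z"
proof -
  have e: "((\<lambda>t. exp (t * c)) \<longlongrightarrow> 1) (at 0)" for c :: real
    by (auto intro!: tendsto_eq_intros)
  have e2: "((\<lambda>t. (exp (t * c))\<^sup>2) \<longlongrightarrow> 1) (at 0)" for c :: real
    using tendsto_power[OF e[of c], of 2] by (simp only: one_power2)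
  have s: "s z > 0" using eventually_nhds_x_imp_x[OF pos] .
  have "C1_tendsto (\<lambda>t w. 1 / exp (t * \<xi>) * (sqrt (1 + s w) * sqrt ((exp (t * \<xi>))\<^sup>2 + (exp (t * \<eta>))\<^sup>2 * s w)))
     (\<lambda>w. 1 / 1 * (sqrt (1 + s w) * sqrt (1 + 1 * s w))) (at 0) z"
    by (intro C1_tendsto_divide C1_tendsto_mult C1_tendsto_sqrt C1_tendsto_add C1_tendsto_const C1
        C1_tendsto_param[OF e] C1_tendsto_param[OF e2]) (use s in auto)
  then show ?thesis
    by (rule C1_tendsto_cong)
      (use pos in \<open>auto simp: site_weight_def case_prod_unfold elim!: eventually_mono\<close>)
qed

text \<open>The numerator vanishes to second order in \<open>t\<close>, which becomes visible after
  multiplying by the conjugate \<open>A s + 1 + R\<close>. The conjugate tends to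
  \<open>2 (1 + s)\<close>, the denominator of the limit.\<close>

lemma C1_tendsto_site_potential:
  assumes C1: "C1_tendsto (\<lambda>_. s) s (at (0::real)) z" and pos: "\<forall>\<^sub>F w in nhds z. s w > 0"
  shows "C1_tendsto (\<lambda>t w. (1/2 * (1 / (exp (t * \<xi>))\<^sup>2 + (exp (t * \<eta>))\<^sup>2) * s w + 1
             - site_weight (exp (t * \<xi>)) (exp (t * \<eta>)) (s w)) / t\<^sup>2)
           (\<lambda>w. ((\<xi> + \<eta>)\<^sup>2 * (s w)\<^sup>2 + 4 * \<xi> * \<eta> * s w) / (2 * (1 + s w))) (at 0) z"
proof -
  define a b where "a t = exp (t * (- \<xi>))" and "b t = exp (t * \<eta>)" for t
  define A where "A t = 1/2 * ((a t)\<^sup>2 + (b t)\<^sup>2)" for t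
  let ?R = "\<lambda>t w. site_weight (exp (t * \<xi>)) (exp (t * \<eta>)) (s w)"
  have s: "s z > 0" using eventually_nhds_x_imp_x[OF pos] .
  have a: "(a \<longlongrightarrow> 1) (at 0)" and b: "(b \<longlongrightarrow> 1) (at 0)"
    unfolding a_def b_def by (auto intro!: tendsto_eq_intros)
  have A: "(A \<longlongrightarrow> 1) (at 0)"
    unfolding A_def by (rule tendsto_eq_intros a b refl | simp)+
  have a1: "((\<lambda>t. (a t - 1) / t) \<longlongrightarrow> - \<xi>) (at 0)" and b1: "((\<lambda>t. (b t - 1) / t) \<longlongrightarrow> \<eta>) (at 0)"
    unfolding a_def b_def by (rule tendsto_exp_quotient)+
  \<comment> \<open>\<open>m1\<close> and \<open>m2\<close> are the coefficients of
    \<open>s^2\<close> and \<open>s\<close> in \<open>(A s + 1)^2 - R^2\<close>, divided by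
    \<open>t^2\<close>. They are written through difference quotients of \<open>a\<close> and
    \<open>b\<close> at 0, so that their limits can be read off.\<close>
  define m1 where "m1 t = 1/2 * ((a t - 1) / t - (b t - 1) / t)\<^sup>2 * (A t + a t * b t)" for t
  define m2 where "m2 t = - ((a t - 1) / t * (a t + 1) * ((b t - 1) / t) * (b t + 1))" for t
  have m1: "(m1 \<longlongrightarrow> (\<xi> + \<eta>)\<^sup>2) (at 0)"
  proof -
    have "(m1 \<longlongrightarrow> 1/2 * (- \<xi> - \<eta>)\<^sup>2 * (1 + 1 * 1)) (at 0)"
      unfolding m1_def by (intro tendsto_intros a1 b1 A a b)
    then show ?thesis by (simp add: power2_eq_square algebra_simps)
  qed
  have m2: "(m2 \<longlongrightarrow> 4 * \<xi> * \<eta>) (at 0)"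
  proof -
    have "(m2 \<longlongrightarrow> - (- \<xi> * (1 + 1) * \<eta> * (1 + 1))) (at 0)"
      unfolding m2_def by (intro tendsto_intros a1 b1 a b)
    then show ?thesis by (simp add: mult_ac)
  qed
  note R = C1_tendsto_site_weight[OF C1 pos, of \<xi> \<eta>]
  have "C1_tendsto (\<lambda>t w. (m1 t * (s w)\<^sup>2 + m2 t * s w) / (A t * s w + 1 + ?R t w))
     (\<lambda>w. ((\<xi> + \<eta>)\<^sup>2 * (s w)\<^sup>2 + 4 * \<xi> * \<eta> * s w) / (1 * s w + 1 + (1 + s w))) (at 0) z"
    by (intro C1_tendsto_divide C1_tendsto_add C1_tendsto_mult C1_tendsto_power C1 R
        C1_tendsto_const C1_tendsto_param m1 m2 A) (use s in auto)
  moreover have "\<forall>\<^sub>F (t, w) in at 0 \<times>\<^sub>F nhds z. t \<noteq> 0 \<and> s w > 0"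
    unfolding eventually_prod_filter using pos
    by (intro exI[of _ "\<lambda>t. t \<noteq> 0"] exI[of _ "\<lambda>w. s w > 0"]) (auto simp: eventually_at_filter)
  then have "\<forall>\<^sub>F (t, w) in at 0 \<times>\<^sub>F nhds z. (m1 t * (s w)\<^sup>2 + m2 t * s w) / (A t * s w + 1 + ?R t w) =
      (1/2 * (1 / (exp (t * \<xi>))\<^sup>2 + (exp (t * \<eta>))\<^sup>2) * s w + 1 - ?R t w) / t\<^sup>2"
  proof eventually_elim
    case (elim x)
    obtain t w where x: "x = (t, w)" by (cases x)
    have t: "t \<noteq> 0" and sw: "s w > 0" using elim x by auto
    have ea: "a t = inverse (exp (t * \<xi>))" by (simp add: a_def exp_minus)
    have A': "1/2 * (1 / (exp (t * \<xi>))\<^sup>2 + (exp (t * \<eta>))\<^sup>2) = A t"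
      by (simp add: A_def ea b_def power_inverse inverse_eq_divide power_one_over)
    have ax: "exp (t * \<xi>) = 1 / a t" and a0: "a t > 0" by (simp_all add: ea inverse_eq_divide)
    have nonneg: "A t > 0" "?R t w > 0"
      using sw by (auto simp: A_def site_weight_def a_def b_def intro!: add_pos_pos mult_pos_pos divide_pos_pos)
    have "(?R t w)\<^sup>2 = (1 + s w) * (1 + (a t)\<^sup>2 * (b t)\<^sup>2 * s w)"
    proof -
      have "(?R t w)\<^sup>2 = (a t)\<^sup>2 * ((sqrt (1 + s w))\<^sup>2 * (sqrt ((1 / a t)\<^sup>2 + (b t)\<^sup>2 * s w))\<^sup>2)"
        unfolding site_weight_def ax b_def[symmetric] by (simp add: power_mult_distrib)
      also have "\<dots> = (a t)\<^sup>2 * ((1 + s w) * ((1 / a t)\<^sup>2 + (b t)\<^sup>2 * s w))"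
        using sw by simp
      also have "\<dots> = (1 + s w) * ((a t * (1 / a t))\<^sup>2 + (a t)\<^sup>2 * (b t)\<^sup>2 * s w)"
        by algebra
      finally show ?thesis using a0 by simp
    qed
    then have "(A t * s w + 1 - ?R t w) * (A t * s w + 1 + ?R t w)
        = (A t * s w + 1)\<^sup>2 - (1 + s w) * (1 + (a t)\<^sup>2 * (b t)\<^sup>2 * s w)"
      by (simp add: algebra_simps power2_eq_square)
    \<comment> \<open>The difference of squares is \<open>s\<^sup>2 (A\<^sup>2 - a\<^sup>2 b\<^sup>2) - s (a\<^sup>2 - 1) (b\<^sup>2 - 1)\<close>, where
      \<open>A - a b = (a - b)\<^sup>2 / 2\<close>.\<close>
    also have "\<dots> = t\<^sup>2 * (m1 t * (s w)\<^sup>2 + m2 t * s w)"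
    proof -
      have q1: "t\<^sup>2 * m1 t = 1/2 * (a t - b t)\<^sup>2 * (A t + a t * b t)"
        using t by (simp add: m1_def diff_divide_distrib[symmetric] power_divide)
      have q2: "t\<^sup>2 * m2 t = - ((a t)\<^sup>2 - 1) * ((b t)\<^sup>2 - 1)"
        using t by (simp add: m2_def power2_eq_square) (simp add: algebra_simps)
      have "t\<^sup>2 * (m1 t * (s w)\<^sup>2 + m2 t * s w) = t\<^sup>2 * m1 t * (s w)\<^sup>2 + t\<^sup>2 * m2 t * s w"
        by (simp add: algebra_simps)
      then show ?thesis unfolding q1 q2 A_def by algebra
    qed
    finally have key: "(A t * s w + 1 - ?R t w) * (A t * s w + 1 + ?R t w) = t\<^sup>2 * (m1 t * (s w)\<^sup>2 + m2 t * s w)" .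
    have "A t * s w + 1 + ?R t w > 0" using nonneg sw by (intro add_pos_pos mult_pos_pos) auto
    then have D: "A t * s w + 1 + ?R t w \<noteq> 0" by simp
    have "(m1 t * (s w)\<^sup>2 + m2 t * s w) * t\<^sup>2 = (A t * s w + 1 - ?R t w) * (A t * s w + 1 + ?R t w)"
      unfolding key by (rule mult.commute)
    then have "(m1 t * (s w)\<^sup>2 + m2 t * s w) / (A t * s w + 1 + ?R t w) = (A t * s w + 1 - ?R t w) / t\<^sup>2"
      using t by (intro frac_eq_eq[OF D, THEN iffD2]) auto
    then show ?case unfolding x prod.case A' .
  qed
  ultimately show ?thesis
    by (rule C1_tendsto_cong) (simp add: algebra_simps)
qed

text \<open>With \<open>S = sinh q\<close> and \<open>C = cosh q\<close>, the square of the hat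
  momentum is \<open>1 + 1 / S^2\<close> times that of the original one. The site term splits by
  partial fractions in \<open>S^2\<close>, using
  \<open>(\<xi> + \<eta>)^2 = (\<xi> - \<eta>)^2 + 4 \<xi> \<eta>\<close>; together with
  \<open>sinh (2 q) = 2 S C\<close> this is where the first two coupling constants come
  from.\<close>

lemma sutherland_BC_hat_coords:
  fixes z :: "'n::{finite,linorder} phase"
  assumes z: "z \<in> phase_space"
  defines "S \<equiv> \<lambda>i. sinh (fst z $ i)"
  shows "sutherland_BC (2 * \<xi> * \<eta>) (2 * (\<xi> - \<eta>)\<^sup>2) (\<zeta>\<^sup>2 / 2) (hat_coords z) =
    (\<Sum>i\<in>UNIV. ((\<xi> + \<eta>)\<^sup>2 * (1 / (S i)\<^sup>2)\<^sup>2 + 4 * \<xi> * \<eta> * (1 / (S i)\<^sup>2)) / (2 * (1 + 1 / (S i)\<^sup>2))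
       + (1 + 1 / (S i)\<^sup>2) * ((snd z $ i)\<^sup>2 / 2 + (\<Sum>k\<in>UNIV - {i}. 2 * \<zeta>\<^sup>2 * pair_potential (S i) (S k))))"
proof -
  define C where "C i = cosh (fst z $ i)" for i
  let ?q = "\<lambda>i. fst z $ i"
  have S0: "S i \<noteq> 0" for i using z by (auto simp: phase_space_def S_def)
  have SS: "(S i)\<^sup>2 - (S k)\<^sup>2 \<noteq> 0" if "i \<noteq> k" for i k
    using z that by (auto simp: phase_space_def S_def)
  have C0: "C i \<noteq> 0" for i unfolding C_def by (metis cosh_real_pos less_irrefl)
  have C2: "(C i)\<^sup>2 = 1 + (S i)\<^sup>2" for i using cosh_square_eq[of "?q i"] by (simp add: C_def S_def)
  have one: "1 / 2 * (inverse (S i) * C i * snd z $ i)\<^sup>2 + 2 * \<xi> * \<eta> * (1 / (S i)\<^sup>2)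
      + 2 * (\<xi> - \<eta>)\<^sup>2 * (1 / (2 * S i * C i)\<^sup>2)
      = ((\<xi> + \<eta>)\<^sup>2 * (1 / (S i)\<^sup>2)\<^sup>2 + 4 * \<xi> * \<eta> * (1 / (S i)\<^sup>2)) / (2 * (1 + 1 / (S i)\<^sup>2))
       + (1 + 1 / (S i)\<^sup>2) * ((snd z $ i)\<^sup>2 / 2)" for i
  proof -
    define s where "s = (S i)\<^sup>2"
    have s: "s > 0" using S0[of i] by (simp add: s_def)
    have "(inverse (S i) * C i * snd z $ i)\<^sup>2 = (1 + 1 / s) * (snd z $ i)\<^sup>2"
      using s by (simp add: power_mult_distrib power_inverse C2 s_def[symmetric] field_simps)
    moreover have "2 * (\<xi> - \<eta>)\<^sup>2 * (1 / (2 * S i * C i)\<^sup>2) = (\<xi> - \<eta>)\<^sup>2 * (1 / (2 * s * (1 + s)))"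
      by (simp add: power_mult_distrib C2 s_def[symmetric])
    ultimately have "1 / 2 * (inverse (S i) * C i * snd z $ i)\<^sup>2 + 2 * \<xi> * \<eta> * (1 / (S i)\<^sup>2)
      + 2 * (\<xi> - \<eta>)\<^sup>2 * (1 / (2 * S i * C i)\<^sup>2) =
      (1 + 1 / s) * ((snd z $ i)\<^sup>2 / 2) + (2 * \<xi> * \<eta> * (1 / s) + (\<xi> - \<eta>)\<^sup>2 * (1 / (2 * s * (1 + s))))"
      by (simp add: s_def)
    also have "2 * \<xi> * \<eta> * (1 / s) + (\<xi> - \<eta>)\<^sup>2 * (1 / (2 * s * (1 + s))) =
        ((\<xi> + \<eta>)\<^sup>2 * (1 / s)\<^sup>2 + 4 * \<xi> * \<eta> * (1 / s)) / (2 * (1 + 1 / s))"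
      using s by (simp add: divide_simps) (simp add: algebra_simps power2_eq_square)
    finally show ?thesis
      by (simp only: s_def add.commute)
  qed
  \<comment> \<open>\<open>F i k\<close> is the pair potential multiplied by the site factor
    \<open>1 + 1 / (S i)^2\<close>. It is not symmetric; the Sutherland pair term is twice its
    symmetrisation, and summing over ordered pairs makes both halves equal.\<close>
  define F where "F i k = (C i)\<^sup>2 * (S k)\<^sup>2 / ((S i)\<^sup>2 - (S k)\<^sup>2)\<^sup>2" for i k
  have E: "1 / (sinh (?q i + ?q k))\<^sup>2 + 1 / (sinh (?q i - ?q k))\<^sup>2 = 2 * (F i k + F k i)" if "i \<noteq> k" for i k
  proof -
    \<comment> \<open>These are the two terms of the addition formula, so \<open>u + v\<close> and
      \<open>u - v\<close> are \<open>sinh\<close> of the sum and of the difference of the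
      positions.\<close>
    define u v where "u = S i * C k" and "v = C i * S k"
    have uv: "(S i)\<^sup>2 - (S k)\<^sup>2 = (u + v) * (u - v)"
      unfolding u_def v_def using C2[of i] C2[of k] by algebra
    with SS[OF that] have ne: "u + v \<noteq> 0" "u - v \<noteq> 0" by auto
    have "F k i = u\<^sup>2 / ((u + v) * (u - v))\<^sup>2" "F i k = v\<^sup>2 / ((u + v) * (u - v))\<^sup>2"
      unfolding uv[symmetric] by (simp_all add: F_def u_def v_def power_mult_distrib power2_commute mult.commute)
    moreover have "1 / (u + v)\<^sup>2 + 1 / (u - v)\<^sup>2 = 2 * (v\<^sup>2 / ((u + v) * (u - v))\<^sup>2 + u\<^sup>2 / ((u + v) * (u - v))\<^sup>2)"
    proof -
      have "1 / (u + v)\<^sup>2 + 1 / (u - v)\<^sup>2 = ((u - v)\<^sup>2 + (u + v)\<^sup>2) / ((u + v) * (u - v))\<^sup>2"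
        using ne by (simp add: power_mult_distrib add_divide_distrib)
      also have "(u - v)\<^sup>2 + (u + v)\<^sup>2 = 2 * (v\<^sup>2 + u\<^sup>2)" by algebra
      finally show ?thesis by (simp add: add_divide_distrib[symmetric])
    qed
    ultimately show ?thesis by (simp add: sinh_add sinh_diff u_def v_def S_def C_def)
  qed
  have swap: "(\<Sum>i\<in>UNIV. \<Sum>k\<in>UNIV - {i}. F k i) = (\<Sum>i\<in>UNIV. \<Sum>k\<in>UNIV - {i}. F i k)"
  proof -
    have D: "UNIV - {i} = {k\<in>UNIV. i \<noteq> k}" "UNIV - {i} = {k\<in>UNIV. k \<noteq> i}" for i :: 'n by auto
    have "(\<Sum>i\<in>UNIV. \<Sum>k\<in>{k\<in>UNIV. i \<noteq> k}. F k i) = (\<Sum>k\<in>UNIV. \<Sum>i\<in>{i\<in>UNIV. i \<noteq> k}. F k i)"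
      by (rule sum.swap_restrict) simp_all
    then show ?thesis by (simp only: D[symmetric])
  qed
  have "(\<Sum>(i, j)\<in>{(i, j). i \<noteq> j}. 1 / (sinh (?q i + ?q j))\<^sup>2 + 1 / (sinh (?q i - ?q j))\<^sup>2)
      = (\<Sum>i\<in>UNIV. \<Sum>k\<in>UNIV - {i}. 1 / (sinh (?q i + ?q k))\<^sup>2 + 1 / (sinh (?q i - ?q k))\<^sup>2)"
    by (subst sum.Sigma) (auto intro!: sum.cong)
  also have "\<dots> = (\<Sum>i\<in>UNIV. \<Sum>k\<in>UNIV - {i}. 2 * (F i k + F k i))"
    by (intro sum.cong refl E) auto
  also have "\<dots> = 4 * (\<Sum>i\<in>UNIV. \<Sum>k\<in>UNIV - {i}. F i k)"
    using swap by (simp add: sum.distrib sum_distrib_left[symmetric])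
  finally have pairs: "\<zeta>\<^sup>2 / 2 * (\<Sum>(i, j)\<in>{(i, j). i \<noteq> j}. 1 / (sinh (?q i + ?q j))\<^sup>2 + 1 / (sinh (?q i - ?q j))\<^sup>2)
      = (\<Sum>i\<in>UNIV. \<Sum>k\<in>UNIV - {i}. 2 * \<zeta>\<^sup>2 * F i k)"
    by (simp add: sum_distrib_left mult_ac)
  have F: "(1 + 1 / (S i)\<^sup>2) * (2 * \<zeta>\<^sup>2 * pair_potential (S i) (S k)) = 2 * \<zeta>\<^sup>2 * F i k" for i k
  proof -
    have "(1 + 1 / (S i)\<^sup>2) * (S i)\<^sup>2 = (C i)\<^sup>2"
      using S0[of i] by (simp add: C2 distrib_right)
    then show ?thesis
      unfolding pair_potential_def F_def by (simp only: times_divide_eq_right mult.assoc[symmetric] flip: power2_eq_square) (simp only: mult_ac)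
  qed
  have "sutherland_BC (2 * \<xi> * \<eta>) (2 * (\<xi> - \<eta>)\<^sup>2) (\<zeta>\<^sup>2 / 2) (hat_coords z) =
     (\<Sum>i\<in>UNIV. 1 / 2 * (inverse (S i) * C i * snd z $ i)\<^sup>2 + 2 * \<xi> * \<eta> * (1 / (S i)\<^sup>2)
       + 2 * (\<xi> - \<eta>)\<^sup>2 * (1 / (2 * S i * C i)\<^sup>2)) + (\<Sum>i\<in>UNIV. \<Sum>k\<in>UNIV - {i}. 2 * \<zeta>\<^sup>2 * F i k)"
    unfolding pairs[symmetric]
    by (simp add: sutherland_BC_def hat_coords_def case_prod_unfold S_def C_def sinh_double
        sum.distrib sum_distrib_left)
  then show ?thesis
    unfolding one by (simp add: distrib_left sum_distrib_left F sum.distrib del: mult_divide_mult_cancel_left_if)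
qed

text \<open>\<open>Phi1_subst\<close> equals \<open>- n + t\<^sup>2 scaled_Phi1\<close> exactly for \<open>t \<noteq> 0\<close>, so all limit statements are about
  \<open>scaled_Phi1\<close>; at \<open>t = 0\<close> it has a junk value.\<close>

definition scaled_Phi1 :: "real \<Rightarrow> real \<Rightarrow> real \<Rightarrow> real \<Rightarrow> 'n::finite phase \<Rightarrow> real" where
  "scaled_Phi1 \<xi> \<eta> \<zeta> t z = (Phi1_subst \<xi> \<eta> \<zeta> t z + real CARD('n)) / t\<^sup>2"

text \<open>Adding 1 at each site accounts for the constant \<open>- n\<close>, and
  \<open>R c\<close> is split as \<open>R - R (1 - c)\<close>. The cosine takes the vacant place
  \<open>k = i\<close> in the product, so that \<open>C1_tendsto_one_minus_prod\<close> treats it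
  like the pair factors.\<close>

lemma Phi1_subst_eq:
  fixes z :: "'n::finite phase"
  defines "S \<equiv> \<lambda>i. sinh (fst z $ i)"
  shows "Phi1_subst \<xi> \<eta> \<zeta> t z = - real CARD('n) + (\<Sum>i\<in>UNIV.
    (1/2 * (1 / (exp (t * \<xi>))\<^sup>2 + (exp (t * \<eta>))\<^sup>2) * (1 / (S i)\<^sup>2) + 1
       - site_weight (exp (t * \<xi>)) (exp (t * \<eta>)) (1 / (S i)\<^sup>2))
    + site_weight (exp (t * \<xi>)) (exp (t * \<eta>)) (1 / (S i)\<^sup>2)
       * (1 - (\<Prod>k\<in>UNIV. if k = i then cos (t * snd z $ i) else pair_factor (exp (t * \<zeta>)) (S i) (S k))))"
proof -
  have P: "(\<Prod>k\<in>UNIV. if k = i then cos (t * snd z $ i) else pair_factor (exp (t * \<zeta>)) (S i) (S k))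
      = cos (t * snd z $ i) * (\<Prod>k\<in>UNIV - {i}. pair_factor (exp (t * \<zeta>)) (S i) (S k))" for i
    by (subst prod.remove[of UNIV i]) auto
  define R where "R i = site_weight (exp (t * \<xi>)) (exp (t * \<eta>)) (1 / (S i)\<^sup>2)" for i
  define A where "A = 1/2 * (1 / (exp (t * \<xi>))\<^sup>2 + (exp (t * \<eta>))\<^sup>2)"
  define c where "c i = cos (t * snd z $ i) * (\<Prod>k\<in>UNIV - {i}. pair_factor (exp (t * \<zeta>)) (S i) (S k))" for i
  have "Phi1_subst \<xi> \<eta> \<zeta> t z = A * (\<Sum>i\<in>UNIV. 1 / (S i)\<^sup>2) - (\<Sum>i\<in>UNIV. R i * c i)"
    by (simp add: Phi1_subst_def Phi1_coord_def Phi1_def scale_momenta_def case_prod_unfold R_def A_def c_def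
        site_weight_def sum_distrib_left S_def mult_ac)
  also have "\<dots> = - real CARD('n) + (\<Sum>i\<in>UNIV. (A * (1 / (S i)\<^sup>2) + 1 - R i) + R i * (1 - c i))"
    by (simp add: sum.distrib sum_subtractf sum_distrib_left right_diff_distrib)
  finally show ?thesis unfolding P A_def R_def c_def .
qed

lemma C1_tendsto_scaled_Phi1:
  fixes z :: "'n::{finite,linorder} phase"
  assumes z: "z \<in> phase_space"
  shows "C1_tendsto (scaled_Phi1 \<xi> \<eta> \<zeta>)
    (\<lambda>w. sutherland_BC (2 * \<xi> * \<eta>) (2 * (\<xi> - \<eta>)\<^sup>2) (\<zeta>\<^sup>2 / 2) (hat_coords w)) (at 0) z"
proof -
  let ?S = "\<lambda>i w :: 'n phase. sinh (fst w $ i)"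
  let ?s = "\<lambda>i w. 1 / (?S i w)\<^sup>2"
  let ?A = "\<lambda>t. 1/2 * (1 / (exp (t * \<xi>))\<^sup>2 + (exp (t * \<eta>))\<^sup>2)"
  let ?R = "\<lambda>i t w. site_weight (exp (t * \<xi>)) (exp (t * \<eta>)) (?s i w)"
  let ?f = "\<lambda>i k t w. if k = i then cos (t * snd w $ i) else pair_factor (exp (t * \<zeta>)) (?S i w) (?S k w)"
  let ?l = "\<lambda>i k w. if k = i then (snd w $ i)\<^sup>2 / 2 else 2 * \<zeta>\<^sup>2 * pair_potential (?S i w) (?S k w)"
  have S: "C1_tendsto (\<lambda>_. ?S i) (?S i) (at (0::real)) z" for i
    by (intro C1_tendsto_sinh C1_tendsto_linear bounded_linear_compose[OF bounded_linear_vec_nth bounded_linear_fst])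
  have S0: "?S i z \<noteq> 0" for i using z by (auto simp: phase_space_def)
  have s: "C1_tendsto (\<lambda>_. ?s i) (?s i) (at (0::real)) z" for i
    by (intro C1_tendsto_divide C1_tendsto_power S C1_tendsto_const) (use S0 in auto)
  have pos: "\<forall>\<^sub>F w in nhds z. ?s i w > 0" for i
    using eventually_phase_space[OF z] by eventually_elim (auto simp: phase_space_def)
  have d: "((\<lambda>t::real. t\<^sup>2) \<longlongrightarrow> 0) (at 0)" "\<forall>\<^sub>F t in at (0::real). t\<^sup>2 \<noteq> 0"
    by (auto intro!: tendsto_eq_intros simp: eventually_at_filter)
  have f: "C1_tendsto (\<lambda>t w. (1 - ?f i k t w) / t\<^sup>2) (?l i k) (at 0) z" for i k
  proof (cases "k = i")
    case True
    have "C1_tendsto (\<lambda>_ w. snd w $ i) (\<lambda>w. snd w $ i) (at (0::real)) z"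
      by (intro C1_tendsto_linear bounded_linear_compose[OF bounded_linear_vec_nth bounded_linear_snd])
    from C1_tendsto_compose[OF C1_tendsto_cos this] True show ?thesis by simp
  next
    case False
    then have "(?S i z)\<^sup>2 \<noteq> (?S k z)\<^sup>2" using z by (auto simp: phase_space_def)
    from C1_tendsto_pair_factor[OF S S this] False show ?thesis by simp
  qed
  have "C1_tendsto (\<lambda>t w. \<Sum>i\<in>UNIV. (?A t * ?s i w + 1 - ?R i t w) / t\<^sup>2
        + ?R i t w * ((1 - (\<Prod>k\<in>UNIV. ?f i k t w)) / t\<^sup>2))
     (\<lambda>w. \<Sum>i\<in>UNIV. ((\<xi> + \<eta>)\<^sup>2 * (?s i w)\<^sup>2 + 4 * \<xi> * \<eta> * ?s i w) / (2 * (1 + ?s i w))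
        + (1 + ?s i w) * (\<Sum>k\<in>UNIV. ?l i k w)) (at 0) z"
    by (intro C1_tendsto_sum C1_tendsto_add C1_tendsto_mult C1_tendsto_one_minus_prod f d
        C1_tendsto_site_potential C1_tendsto_site_weight s pos) simp_all
  then show ?thesis
  proof (rule C1_tendsto_cong)
    have "(\<Sum>i\<in>UNIV. (?A t * ?s i w + 1 - ?R i t w) / t\<^sup>2
        + ?R i t w * ((1 - (\<Prod>k\<in>UNIV. ?f i k t w)) / t\<^sup>2)) = scaled_Phi1 \<xi> \<eta> \<zeta> t w" for t w
      unfolding scaled_Phi1_def Phi1_subst_eq
      by (simp add: sum_divide_distrib add_divide_distrib)
    then show "\<forall>\<^sub>F (t, w) in at 0 \<times>\<^sub>F nhds z. (\<Sum>i\<in>UNIV. (?A t * ?s i w + 1 - ?R i t w) / t\<^sup>2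
        + ?R i t w * ((1 - (\<Prod>k\<in>UNIV. ?f i k t w)) / t\<^sup>2)) = scaled_Phi1 \<xi> \<eta> \<zeta> t w"
      by (simp only: case_prod_unfold) simp
    have l: "(\<Sum>k\<in>UNIV. ?l i k w) = (snd w $ i)\<^sup>2 / 2 + (\<Sum>k\<in>UNIV - {i}. 2 * \<zeta>\<^sup>2 * pair_potential (?S i w) (?S k w))" for i w
      by (subst sum.remove[of UNIV i]) auto
    show "\<forall>\<^sub>F w in nhds z. (\<Sum>i\<in>UNIV. ((\<xi> + \<eta>)\<^sup>2 * (?s i w)\<^sup>2 + 4 * \<xi> * \<eta> * ?s i w) / (2 * (1 + ?s i w))
        + (1 + ?s i w) * (\<Sum>k\<in>UNIV. ?l i k w))
        = sutherland_BC (2 * \<xi> * \<eta>) (2 * (\<xi> - \<eta>)\<^sup>2) (\<zeta>\<^sup>2 / 2) (hat_coords w)"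
      using eventually_phase_space[OF z]
      by eventually_elim (simp only: sutherland_BC_hat_coords l)
  qed
qed

lemma real_analytic_at_0_Phi1_subst:
  fixes z :: "'n::{finite,linorder} phase"
  assumes z: "z \<in> phase_space"
  shows "real_analytic_at_0 (\<lambda>t. Phi1_subst \<xi> \<eta> \<zeta> t z)"
proof -
  have S0: "sinh (fst z $ i) \<noteq> 0" for i using z by (auto simp: phase_space_def)
  show ?thesis
    unfolding Phi1_subst_def Phi1_coord_def Phi1_def scale_momenta_def case_prod_unfold pair_factor_def
      divide_inverse fst_conv snd_conv vec_lambda_beta vector_scaleR_component real_scaleR_def
    \<comment> \<open>The simplifier discharges the side conditions at \<open>t = 0\<close>: there
      the radicands are \<open>1 + 1 / S^2\<close>, twice, and 1 in the pair factors.\<close>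
    by (rule real_analytic_at_0_const real_analytic_at_0_ident
        real_analytic_at_0_sum real_analytic_at_0_prod real_analytic_at_0_add real_analytic_at_0_diff
        real_analytic_at_0_mult real_analytic_at_0_power real_analytic_at_0_exp
        real_analytic_at_0_cos real_analytic_at_0_inverse real_analytic_at_0_sqrt
      | (simp add: add_pos_nonneg; fail))+
qed

section \<open>Symplectic forms and Hamiltonian vector fields\<close>

lemma differential_bounded_linear:
  "bounded_linear f \<Longrightarrow> differential f z = f"
  by (rule frechet_derivative_at[symmetric, OF bounded_linear_imp_has_derivative])

lemma bounded_linear_position: "bounded_linear (\<lambda>w :: 'n::finite phase. fst w $ i)"
  by (rule bounded_linear_compose[OF bounded_linear_vec_nth bounded_linear_fst])

lemma bounded_linear_momentum: "bounded_linear (\<lambda>w :: 'n::finite phase. snd w $ i)"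
  by (rule bounded_linear_compose[OF bounded_linear_vec_nth bounded_linear_snd])

definition coth_form :: "'n::finite phase \<Rightarrow> 'n phase \<Rightarrow> 'n phase \<Rightarrow> real" where
  "coth_form z u v = (\<Sum>i\<in>UNIV. inverse (sinh (fst z $ i)) * cosh (fst z $ i) *
     (snd u $ i * fst v $ i - snd v $ i * fst u $ i))"

text \<open>The factor \<open>t\<close> comes from \<open>dp = t d\<pi>\<close>, and the logarithmic
  differential of \<open>sinh\<close> is \<open>coth\<close> times the differential of the
  position.\<close>

lemma pullback_scale_momenta_reduced_form:
  fixes z :: "'n::finite phase"
  shows "pullback (scale_momenta t) (reduced_form \<kappa>) z u v = \<kappa> * t * coth_form z u v"
proof -
  have "bounded_linear (scale_momenta t :: 'n phase \<Rightarrow> 'n phase)"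
    unfolding scale_momenta_def case_prod_unfold
    by (intro bounded_linear_Pair bounded_linear_fst bounded_linear_compose[OF bounded_linear_scaleR_right bounded_linear_snd])
  then have d: "differential (scale_momenta t :: 'n phase \<Rightarrow> 'n phase) z = scale_momenta t"
    by (rule differential_bounded_linear)
  have sinh: "differential (\<lambda>w. sinh (fst w $ i)) x = (\<lambda>w. cosh (fst x $ i) * fst w $ i)" for i and x :: "'n phase"
  proof (rule frechet_derivative_at[symmetric])
    have "((\<lambda>w. fst w $ i) has_derivative (\<lambda>w. fst w $ i)) (at x)"
      by (rule bounded_linear_imp_has_derivative[OF bounded_linear_position])
    moreover have "(sinh has_derivative (*) (cosh (fst x $ i))) (at (fst x $ i))"
      using has_field_derivative_sinh[OF DERIV_ident] by (simp add: has_field_derivative_def)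
    ultimately show "((\<lambda>w. sinh (fst w $ i)) has_derivative (\<lambda>w. cosh (fst x $ i) * fst w $ i)) (at x)"
      by (rule has_derivative_compose)
  qed
  show ?thesis
    unfolding pullback_def reduced_form_def d wedge_def sinh differential_bounded_linear[OF bounded_linear_momentum]
    by (simp add: coth_form_def scale_momenta_def case_prod_unfold sum_distrib_left)
       (auto intro!: sum.cong simp: algebra_simps)
qed

text \<open>The differential of a hat momentum has a second term, from differentiating
  \<open>coth\<close>, proportional to the differential of the same position. The wedge product with
  that differential kills it.\<close>

lemma pullback_hat_coords_canonical_form:
  fixes z :: "'n::{finite,linorder} phase"
  assumes z: "z \<in> phase_space"
  shows "pullback hat_coords canonical_form z u v = coth_form z u v"
proof -
  define c where "c x = inverse (sinh x) * cosh x" for x :: real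
  define c' where "c' i = - inverse ((sinh (fst z $ i))\<^sup>2)" for i
  define D :: "'n phase \<Rightarrow> 'n phase" where
    "D w = (fst w, \<chi> i. c (fst z $ i) * snd w $ i + c' i * fst w $ i * snd z $ i)" for w
  have c: "(c has_real_derivative c' i) (at (fst z $ i))" for i
  proof -
    have s: "sinh (fst z $ i) \<noteq> 0" using z by (auto simp: phase_space_def)
    show ?thesis unfolding c_def[abs_def] c'_def
      by (rule derivative_eq_intros refl s | simp add: s)+
        (use s in \<open>simp add: field_simps power2_eq_square cosh_square_eq[unfolded power2_eq_square]\<close>)
  qed
  have fst_i: "((\<lambda>w. fst w $ i) has_derivative (\<lambda>w. fst w $ i)) (at z)" and
    snd_i: "((\<lambda>w. snd w $ i) has_derivative (\<lambda>w. snd w $ i)) (at z)" for i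
    by (rule bounded_linear_imp_has_derivative[OF bounded_linear_position]
        bounded_linear_imp_has_derivative[OF bounded_linear_momentum])+
  have comp: "((\<lambda>w. c (fst w $ i) * snd w $ i) has_derivative
      (\<lambda>w. c (fst z $ i) * snd w $ i + c' i * fst w $ i * snd z $ i)) (at z)" for i
    using has_derivative_mult[OF has_derivative_compose[OF fst_i c[THEN has_field_derivative_imp_has_derivative]] snd_i]
    by simp
  have "((\<lambda>w. \<chi> i. c (fst w $ i) * snd w $ i) has_derivative
      (\<lambda>w. \<chi> i. c (fst z $ i) * snd w $ i + c' i * fst w $ i * snd z $ i)) (at z)"
    by (subst has_derivative_componentwise_within)
       (auto simp: Basis_vec_def inner_axis intro: comp)
  then have "((\<lambda>w. (fst w, \<chi> i. c (fst w $ i) * snd w $ i)) has_derivative D) (at z)"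
    unfolding D_def[abs_def]
    by (intro has_derivative_Pair bounded_linear_imp_has_derivative[OF bounded_linear_fst])
  also have "(\<lambda>w. (fst w, \<chi> i. c (fst w $ i) * snd w $ i)) = (hat_coords :: 'n phase \<Rightarrow> 'n phase)"
    by (simp add: hat_coords_def c_def fun_eq_iff)
  finally have d: "differential hat_coords z = D" by (rule frechet_derivative_at[symmetric])
  show ?thesis
    unfolding pullback_def canonical_form_def d wedge_def differential_bounded_linear[OF bounded_linear_momentum]
      differential_bounded_linear[OF bounded_linear_position] coth_form_def
    by (auto intro!: sum.cong simp: D_def c_def algebra_simps)
qed

text \<open>Membership in \<open>phase_space\<close> depends only on the positions, which are kept
  fixed; each momentum is multiplied by a nonzero \<open>coth\<close>.\<close>

lemma bij_betw_hat_coords: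
  "bij_betw hat_coords (phase_space :: 'n::{finite,linorder} phase set) phase_space"
proof (rule bij_betwI)
  let ?g = "\<lambda>(q, p). (q, \<chi> i. inverse (inverse (sinh (q $ i)) * cosh (q $ i)) * p $ i) :: 'n phase"
  show "hat_coords \<in> phase_space \<rightarrow> (phase_space :: 'n phase set)"
    by (auto simp: hat_coords_def phase_space_def)
  show "?g \<in> phase_space \<rightarrow> phase_space"
    by (auto simp: phase_space_def)
  have c: "cosh x \<noteq> 0" for x :: real by (metis cosh_real_pos less_irrefl)
  show "?g (hat_coords z) = z" if "z \<in> phase_space" for z
    using that c by (auto simp: hat_coords_def phase_space_def vec_eq_iff field_simps)
  show "hat_coords (?g z) = z" if "z \<in> phase_space" for z
    using that c by (auto simp: hat_coords_def phase_space_def vec_eq_iff field_simps)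
qed

text \<open>This solves Hamilton's equations for \<open>coth_form\<close>: inverting its
  coefficients gives \<open>tanh\<close> times the partial derivatives. The explicit formula makes
  the field depend continuously on the differential of \<open>H\<close>.\<close>

definition hamiltonian_field :: "('n::finite phase \<Rightarrow> real) \<Rightarrow> 'n phase \<Rightarrow> 'n phase" where
  "hamiltonian_field H z =
     ((\<chi> i. sinh (fst z $ i) / cosh (fst z $ i) * differential H z (0, axis i 1)),
      (\<chi> i. - (sinh (fst z $ i) / cosh (fst z $ i) * differential H z (axis i 1, 0))))"

lemma hamiltonian_vector_hamiltonian_field:
  fixes z :: "'n::{finite,linorder} phase"
  assumes z: "z \<in> phase_space" and H: "H differentiable at z"
    and \<omega>: "\<And>u v. \<omega> z u v = coth_form z u v"
  shows "hamiltonian_vector \<omega> H z (hamiltonian_field H z)"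
  unfolding hamiltonian_vector_def
proof (intro conjI allI H)
  fix v :: "'n phase"
  let ?L = "differential H z"
  have lin: "linear ?L"
    using H by (simp add: frechet_derivative_works has_derivative_linear)
  have "v = (\<Sum>i\<in>UNIV. fst v $ i *\<^sub>R (axis i 1, 0) + snd v $ i *\<^sub>R (0, axis i 1))"
    by (auto simp: prod_eq_iff fst_sum snd_sum vec_eq_iff axis_def if_distrib cong: if_cong)
  then have "?L v = ?L (\<Sum>i\<in>UNIV. fst v $ i *\<^sub>R (axis i 1, 0) + snd v $ i *\<^sub>R (0, axis i 1))" by simp
  also have "\<dots> = (\<Sum>i\<in>UNIV. fst v $ i * ?L (axis i 1, 0) + snd v $ i * ?L (0, axis i 1))"
    by (simp add: linear_sum[OF lin] linear_add[OF lin] linear_cmul[OF lin] del: scaleR_Pair)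
  finally have L: "?L v = (\<Sum>i\<in>UNIV. fst v $ i * ?L (axis i 1, 0) + snd v $ i * ?L (0, axis i 1))" .
  have c: "cosh x \<noteq> 0" for x :: real by (metis cosh_real_pos less_irrefl)
  have s: "sinh (fst z $ i) \<noteq> 0" for i using z by (auto simp: phase_space_def)
  show "\<omega> z (hamiltonian_field H z) v = - ?L v"
    unfolding L \<omega> coth_form_def sum_negf[symmetric] hamiltonian_field_def
    using c s by (intro sum.cong refl) (simp add: right_diff_distrib mult.assoc[symmetric])
qed

lemma tendsto_hamiltonian_field:
  assumes "\<And>v. ((\<lambda>(t, w). differential (h t) w v) \<longlongrightarrow> differential g z v) (A \<times>\<^sub>F nhds z)"
  shows "((\<lambda>(t, w). hamiltonian_field (h t) w) \<longlongrightarrow> hamiltonian_field g z) (A \<times>\<^sub>F nhds z)"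
proof -
  have c: "cosh x \<noteq> 0" for x :: real by (metis cosh_real_pos less_irrefl)
  have "((\<lambda>x. fst (snd x) $ i) \<longlongrightarrow> fst z $ i) (A \<times>\<^sub>F nhds z)" for i
    by (intro tendsto_intros filterlim_snd)
  then show ?thesis
    unfolding hamiltonian_field_def case_prod_unfold
    by (intro tendsto_Pair tendsto_vec_lambda tendsto_mult tendsto_divide tendsto_minus tendsto_sinh tendsto_cosh
        assms[unfolded case_prod_unfold] c)
qed

section \<open>Passing between the reduced Hamiltonian and its rescaling\<close>

lemma Phi1_subst_eq_scaled:
  "t \<noteq> 0 \<Longrightarrow> Phi1_subst \<xi> \<eta> \<zeta> t (z :: 'n::finite phase) = - real CARD('n) + t\<^sup>2 * scaled_Phi1 \<xi> \<eta> \<zeta> t z"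
  by (simp add: scaled_Phi1_def)

lemma has_derivative_Phi1_subst:
  fixes z :: "'n::finite phase"
  assumes "t \<noteq> 0" "scaled_Phi1 \<xi> \<eta> \<zeta> t differentiable at z"
  shows "(Phi1_subst \<xi> \<eta> \<zeta> t has_derivative (\<lambda>v. t\<^sup>2 * differential (scaled_Phi1 \<xi> \<eta> \<zeta> t) z v)) (at z)"
proof -
  have "((\<lambda>w. - real CARD('n) + t\<^sup>2 * scaled_Phi1 \<xi> \<eta> \<zeta> t w) has_derivative
      (\<lambda>v. 0 + t\<^sup>2 * differential (scaled_Phi1 \<xi> \<eta> \<zeta> t) z v)) (at z)"
    using assms(2) by (intro has_derivative_add has_derivative_const has_derivative_mult_right)
      (simp add: frechet_derivative_works)
  also have "(\<lambda>w :: 'n phase. - real CARD('n) + t\<^sup>2 * scaled_Phi1 \<xi> \<eta> \<zeta> t w) = Phi1_subst \<xi> \<eta> \<zeta> t"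
    by (simp add: Phi1_subst_eq_scaled[OF assms(1)] fun_eq_iff)
  finally show ?thesis by simp
qed

text \<open>The additive constant drops out on differentiation. The remaining factor
  \<open>t^2\<close> is the reason for the rescaling by \<open>1 / t^2\<close> of the vector fields
  in the limit.\<close>

lemma hamiltonian_field_Phi1_subst:
  fixes z :: "'n::finite phase"
  assumes "t \<noteq> 0" "scaled_Phi1 \<xi> \<eta> \<zeta> t differentiable at z"
  shows "hamiltonian_field (scaled_Phi1 \<xi> \<eta> \<zeta> t) z = (1 / t\<^sup>2) *\<^sub>R hamiltonian_field (Phi1_subst \<xi> \<eta> \<zeta> t) z"
  using assms(1) unfolding hamiltonian_field_def frechet_derivative_at[OF has_derivative_Phi1_subst[OF assms], symmetric]
  by (simp add: vec_eq_iff)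

text \<open>This expresses that the family has three independent parameters: the couplings fill at
  least the open positive octant.\<close>

lemma interior_range_couplings:
  "interior (range (\<lambda>(a, b, d). (2 * a * b, 2 * (a - b)\<^sup>2, d\<^sup>2 / 2)) :: (real \<times> real \<times> real) set) \<noteq> {}"
proof -
  let ?U = "{0<..} \<times> {0<..} \<times> {0<..} :: (real \<times> real \<times> real) set"
  have "?U \<subseteq> range (\<lambda>(a, b, d). (2 * a * b, 2 * (a - b)\<^sup>2, d\<^sup>2 / 2))"
  proof
    fix u :: "real \<times> real \<times> real" assume "u \<in> ?U"
    then obtain p q r where u: "u = (p, q, r)" and pos: "p > 0" "q > 0" "r > 0" by auto
    \<comment> \<open>\<open>m\<close> and \<open>D\<close> are the desired \<open>a - b\<close> and
      \<open>a + b\<close>: the second coupling fixes \<open>(a - b)^2 = q / 2\<close>, and the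
      first gives \<open>(a + b)^2 - (a - b)^2 = 4 a b = 2 p\<close>.\<close>
    define m where "m = sqrt (q / 2)"
    define D where "D = sqrt (m\<^sup>2 + 2 * p)"
    have m2: "m\<^sup>2 = q / 2" using pos by (simp add: m_def)
    have D2: "D\<^sup>2 = m\<^sup>2 + 2 * p" using pos by (simp add: D_def)
    have "2 * ((D + m) / 2) * ((D - m) / 2) = (D\<^sup>2 - m\<^sup>2) / 2" by (simp add: field_simps power2_eq_square)
    then have "2 * ((D + m) / 2) * ((D - m) / 2) = p" by (simp add: D2)
    moreover have "(D + m) / 2 - (D - m) / 2 = m" by (simp add: field_simps)
    moreover have "(sqrt (2 * r))\<^sup>2 / 2 = r" using pos by simp
    ultimately show "u \<in> range (\<lambda>(a, b, d). (2 * a * b, 2 * (a - b)\<^sup>2, d\<^sup>2 / 2))"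
      using m2 unfolding u by (intro image_eqI[of _ _ "((D + m) / 2, (D - m) / 2, sqrt (2 * r))"]) auto
  qed
  moreover have "open ?U" by (intro open_Times open_greaterThan)
  ultimately have "?U \<subseteq> interior (range (\<lambda>(a, b, d). (2 * a * b, 2 * (a - b)\<^sup>2, d\<^sup>2 / 2)))"
    by (rule interior_maximal)
  moreover have "(1, 1, 1) \<in> ?U" by simp
  ultimately show ?thesis by blast
qed

theorem mainTheorem2:
  fixes \<xi> \<eta> \<zeta> \<kappa> :: real
  assumes "\<kappa> \<noteq> 0"
  shows
    "let M = (phase_space :: 'n::{finite,linorder} phase set);
         c1 = (\<lambda>a b d :: real. 2 * a * b);
         c2 = (\<lambda>a b d :: real. 2 * (a - b)\<^sup>2);
         c3 = (\<lambda>a b d :: real. d\<^sup>2 / 2);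
         H2 = sutherland_BC (c1 \<xi> \<eta> \<zeta>) (c2 \<xi> \<eta> \<zeta>) (c3 \<xi> \<eta> \<zeta>)
     in
       (\<exists>H :: nat \<Rightarrow> 'n phase \<Rightarrow> real.
          (\<forall>z\<in>M. \<forall>\<^sub>F t in nhds 0. (\<lambda>k. t ^ k * H k z) sums Phi1_subst \<xi> \<eta> \<zeta> t z) \<and>
          (\<forall>z\<in>M. H 0 z = - real CARD('n) \<and> H 1 z = 0 \<and> H 2 z = H2 (hat_coords z))) \<and>
       bij_betw hat_coords M M \<and>
       (\<exists>c :: real \<Rightarrow> real.
          (\<forall>t. t \<noteq> 0 \<longrightarrow> c t \<noteq> 0 \<and>
            (\<forall>z\<in>M. \<forall>u v. c t * pullback (scale_momenta t) (reduced_form \<kappa>) z u v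
                       = pullback hat_coords canonical_form z u v)) \<and>
          (\<exists>X Y.
            (\<forall>z\<in>M. hamiltonian_vector (pullback hat_coords canonical_form)
                      (\<lambda>w. H2 (hat_coords w)) z (Y z)) \<and>
            (\<forall>K. compact K \<longrightarrow> K \<subseteq> M \<longrightarrow>
              (\<forall>\<^sub>F t in at 0. \<forall>z\<in>K. hamiltonian_vector
                 (\<lambda>z u v. c t * pullback (scale_momenta t) (reduced_form \<kappa>) z u v)
                 (Phi1_subst \<xi> \<eta> \<zeta> t) z (X t z)) \<and>
              uniform_limit K (\<lambda>t z. (1 / t\<^sup>2) *\<^sub>R X t z) Y (at 0)))) \<and>
       interior (range (\<lambda>(a, b, d). (c1 a b d, c2 a b d, c3 a b d))) \<noteq> {}"
proof -
  define G :: "'n phase \<Rightarrow> real" where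
    "G w = sutherland_BC (2 * \<xi> * \<eta>) (2 * (\<xi> - \<eta>)\<^sup>2) (\<zeta>\<^sup>2 / 2) (hat_coords w)" for w
  define \<Phi> :: "real \<Rightarrow> 'n phase \<Rightarrow> real" where "\<Phi> = Phi1_subst \<xi> \<eta> \<zeta>"
  have C1: "C1_tendsto (scaled_Phi1 \<xi> \<eta> \<zeta>) G (at 0) z" if "z \<in> phase_space" for z
    using C1_tendsto_scaled_Phi1[OF that] unfolding G_def[abs_def] .
  note C1' = C1_tendsto_frechet_derivative[OF C1]
  have ne: "\<forall>\<^sub>F (t, w) in at (0::real) \<times>\<^sub>F nhds z. t \<noteq> 0" for z :: "'n phase"
    unfolding eventually_prod_filter
    by (intro exI[of _ "\<lambda>t. t \<noteq> 0"] exI[of _ "\<lambda>_. True"]) (auto simp: eventually_at_filter)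
  have expansion: "\<exists>a. (\<forall>\<^sub>F t in nhds 0. (\<lambda>k. t ^ k * a k) sums \<Phi> t z) \<and>
      a 0 = - real CARD('n) \<and> a 1 = 0 \<and> a 2 = G z" if z: "z \<in> phase_space" for z
  proof -
    obtain a where a: "\<forall>\<^sub>F t in nhds 0. (\<lambda>k. t ^ k * a k) sums \<Phi> t z"
      using real_analytic_at_0_imp_sums[OF real_analytic_at_0_Phi1_subst[OF z]] unfolding \<Phi>_def by blast
    \<comment> \<open>The joint limit is restricted to the slice where the phase space point stays
      equal to \<open>z\<close>.\<close>
    have "filterlim (\<lambda>t. (t, z)) (at (0::real) \<times>\<^sub>F nhds z) (at 0)"
      by (intro filterlim_Pair filterlim_ident tendsto_const)
    from filterlim_compose[OF C1'(4)[OF z] this]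
    have "((\<lambda>t. scaled_Phi1 \<xi> \<eta> \<zeta> t z) \<longlongrightarrow> G z) (at 0)" by simp
    from power_series_second_order[OF a _ this] a show ?thesis
      using Phi1_subst_eq_scaled unfolding \<Phi>_def by blast
  qed
  \<comment> \<open>This cancels the constant of proportionality and the factor \<open>t\<close>
    from scaling the momenta. What remains is \<open>coth_form\<close>, independent of
    \<open>t\<close>.\<close>
  define c where "c t = 1 / (\<kappa> * t)" for t
  have c: "c t * pullback (scale_momenta t) (reduced_form \<kappa>) z u v = coth_form z u v" if "t \<noteq> 0"
    for t and z u v :: "'n phase"
    using that assms by (simp add: c_def pullback_scale_momenta_reduced_form)
  have H: "\<exists>H. (\<forall>z\<in>phase_space. \<forall>\<^sub>F t in nhds 0. (\<lambda>k. t ^ k * H k z) sums \<Phi> t z) \<and>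
      (\<forall>z\<in>phase_space. H 0 z = - real CARD('n) \<and> H 1 z = 0 \<and> H 2 z = G z)"
  proof -
    have "\<forall>z\<in>phase_space. \<exists>a. (\<forall>\<^sub>F t in nhds 0. (\<lambda>k. t ^ k * a k) sums \<Phi> t z) \<and>
      a 0 = - real CARD('n) \<and> a 1 = 0 \<and> a 2 = G z" using expansion by blast
    from bchoice[OF this] obtain a where "\<forall>z\<in>phase_space. (\<forall>\<^sub>F t in nhds 0. (\<lambda>k. t ^ k * a z k) sums \<Phi> t z) \<and>
      a z 0 = - real CARD('n) \<and> a z 1 = 0 \<and> a z 2 = G z" by (elim exE)
    then show ?thesis by (intro exI[of _ "\<lambda>k z. a z k"]) blast
  qed
  have symplectic: "\<forall>t. t \<noteq> 0 \<longrightarrow> c t \<noteq> 0 \<and> (\<forall>z\<in>phase_space. \<forall>u v :: 'n phase.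
      c t * pullback (scale_momenta t) (reduced_form \<kappa>) z u v = pullback hat_coords canonical_form z u v)"
    using c assms by (auto simp: pullback_hat_coords_canonical_form) (simp add: c_def)
  have Y: "\<forall>z\<in>phase_space. hamiltonian_vector (pullback hat_coords canonical_form) G z (hamiltonian_field G z)"
    by (auto intro!: hamiltonian_vector_hamiltonian_field C1'(2) pullback_hat_coords_canonical_form)
  have X: "\<forall>\<^sub>F t in at 0. \<forall>z\<in>K. hamiltonian_vector
        (\<lambda>z u v. c t * pullback (scale_momenta t) (reduced_form \<kappa>) z u v) (\<Phi> t) z (hamiltonian_field (\<Phi> t) z)"
    if K: "compact K" "K \<subseteq> phase_space" for K
  proof (rule eventually_all_compact[OF K(1)])
    fix z assume "z \<in> K"
    then have z: "z \<in> phase_space" using K by blast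
    have "\<forall>\<^sub>F (t, w) in at (0::real) \<times>\<^sub>F nhds z. w \<in> phase_space"
      using eventually_compose_filterlim[OF eventually_phase_space[OF z] filterlim_snd]
      by (simp add: case_prod_unfold)
    with ne C1'(1)[OF z] show "\<forall>\<^sub>F (t, w) in at 0 \<times>\<^sub>F nhds z. hamiltonian_vector
        (\<lambda>z u v. c t * pullback (scale_momenta t) (reduced_form \<kappa>) z u v) (\<Phi> t) w (hamiltonian_field (\<Phi> t) w)"
    proof eventually_elim
      case (elim x)
      obtain t w where x: "x = (t, w)" by (cases x)
      have "\<Phi> t differentiable at w"
        using has_derivative_Phi1_subst[of t \<xi> \<eta> \<zeta> w] elim unfolding x \<Phi>_def differentiable_def by auto
      then show ?case using elim c unfolding x by (auto intro!: hamiltonian_vector_hamiltonian_field)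
    qed
  qed
  have lim: "uniform_limit K (\<lambda>t z. (1 / t\<^sup>2) *\<^sub>R hamiltonian_field (\<Phi> t) z) (hamiltonian_field G) (at 0)"
    if K: "compact K" "K \<subseteq> phase_space" for K
  proof (rule uniform_limit_compact[OF K(1)])
    fix z assume "z \<in> K"
    then have z: "z \<in> phase_space" using K by blast
    \<comment> \<open>For \<open>t\<close> nonzero the rescaled field is the field of
      \<open>scaled_Phi1\<close>, whose differential converges jointly.\<close>
    have "\<forall>\<^sub>F x in at (0::real) \<times>\<^sub>F nhds z. (case x of (t, w) \<Rightarrow> hamiltonian_field (scaled_Phi1 \<xi> \<eta> \<zeta> t) w)
        = (case x of (t, w) \<Rightarrow> (1 / t\<^sup>2) *\<^sub>R hamiltonian_field (\<Phi> t) w)"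
      using ne C1'(1)[OF z]
      by eventually_elim (auto simp: \<Phi>_def hamiltonian_field_Phi1_subst)
    then show "((\<lambda>(t, w). (1 / t\<^sup>2) *\<^sub>R hamiltonian_field (\<Phi> t) w) \<longlongrightarrow> hamiltonian_field G z) (at 0 \<times>\<^sub>F nhds z)"
      by (rule Lim_transform_eventually[OF tendsto_hamiltonian_field[OF C1'(3)[OF z]]])
  qed simp
  show ?thesis
    unfolding Let_def G_def[symmetric] \<Phi>_def[symmetric]
  proof (intro conjI)
    show "\<exists>c :: real \<Rightarrow> real. (\<forall>t. t \<noteq> 0 \<longrightarrow> c t \<noteq> 0 \<and> (\<forall>z\<in>phase_space. \<forall>u v :: 'n phase.
        c t * pullback (scale_momenta t) (reduced_form \<kappa>) z u v = pullback hat_coords canonical_form z u v)) \<and>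
      (\<exists>X Y. (\<forall>z\<in>phase_space. hamiltonian_vector (pullback hat_coords canonical_form) G z (Y z)) \<and>
        (\<forall>K. compact K \<longrightarrow> K \<subseteq> phase_space \<longrightarrow>
          (\<forall>\<^sub>F t in at 0. \<forall>z\<in>K. hamiltonian_vector
             (\<lambda>z u v. c t * pullback (scale_momenta t) (reduced_form \<kappa>) z u v) (\<Phi> t) z (X t z)) \<and>
          uniform_limit K (\<lambda>t z. (1 / t\<^sup>2) *\<^sub>R X t z) Y (at 0)))"
      using symplectic Y X lim
      by (intro exI[of _ c] conjI exI[of _ "\<lambda>t. hamiltonian_field (\<Phi> t)"] exI[of _ "hamiltonian_field G"] allI impI)
         auto
  qed (use H bij_betw_hat_coords interior_range_couplings in auto)
qed

end
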